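(* Let $(x_k)$ be the iterates generated by the BUP-TR trust-region method described in the context, with the hard-MAP model, and suppose that all of the following hold. (1) (Smoothness and lower boundedness) $f$ is continuously differentiable on a neighborhood containing all trust regions visited by the algorithm, its gradient is Lipschitz with constant $L_g>0$, i.e. $\|\nabla f(x)-\nabla f(z)\|_2\le L_g\|x-z\|_2$, and $f$ is bounded below by some $f_{\inf}\in\mathbb{R}$. (2) (Trust-region parameters) The trust-region update uses fixed constants $0<\eta_1\le\eta_2<1$ and $0<\gamma_{\mathrm{dec}}<1<\gamma_{\mathrm{inc}}$. (3) (Subproblem decrease) If $g_k\ne 0$, the computed step satisfies $\|s_k\|_2\le\Delta_k$ and $\mathrm{pred}_k\ge\frac12\|g_k\|_2\min\{\Delta_k,\ \|g_k\|_2/\|H_k\|_2\}$, with the convention $\|g_k\|_2/\|H_k\|_2:=+\infty$ when $\|H_k\|_2=0$; if $g_k=0$, the algorithm either returns $s_k=0$ or a boundary step along a detected negative-curvature direction such that $\mathrm{pred}_k>0$. (4) (Precision bounds) $w_{\min}I\preceq\widehat W_k\preceq w_{\max}I$ for all $k$, where $0<w_{\min}\le w_{\max}<\infty$. (5) (MAP-poisedness) After geometry management, $\lambda_{\min}\big(\widehat A_k\widehat W_k^{-1}\widehat A_k^\top\big)\ge\mu_M$ for all $k$, where $\mu_M>0$ is fixed. (6) (Prior accuracy at the trust-region scale) $\|\widehat c_k^\pi-\widehat c_k^\ell\|_{\widehat W_k}\le\bar\kappa_\pi\Delta_k^2$ for all $k$, for some constant $\bar\kappa_\pi\ge 0$,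 where $\widehat c_k^\ell=[f(x_k);\ \Delta_k\nabla f(x_k);\ 0]\in\mathbb{R}^q$ is the scaled coefficient vector of the linear Taylor model $f(x_k)+\nabla f(x_k)^\top s$. (7) (Criticality safeguard) There exists $\kappa_\Delta>0$ such that whenever $\|g_k\|_2\le\kappa_\Delta\Delta_k$, the algorithm reduces $\Delta_k$ and rebuilds a MAP-poised set and model, repeating until $\|g_k\|_2>\kappa_\Delta\Delta_k$ (or a stopping test is met). (8) (Repair cost) The geometry mechanism, used with attempt budget $T_{\mathrm{try}}$ and threshold $\mu_M\le\mu_0:=\frac{1}{w_{\max}(4n+3)}$, spends at every main iteration at most $T_{\mathrm{try}}+2n$ non-trial objective evaluations in a single pass of the criticality loop, and each additional criticality shrink within the same iteration adds at most $T_{\mathrm{try}}+2n$ further evaluations. Then there exists a constant $C_{\mathrm{eval}}>0$, independent of $\varepsilon$, such that for any $\varepsilon\in(0,1]$ there exists a generated iterate $x_j$ satisfying $\|\nabla f(x_j)\|_2\le\varepsilon$ among the iterates obtained after at most $C_{\mathrm{eval}}\,\varepsilon^{-2}$ objective evaluations.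
   Context: Problem: minimize $f:\mathbb{R}^n\to\mathbb{R}$ using function values only. $B(x,r)=\{z:\|z-x\|_2\le r\}$; $\|v\|_W:=\sqrt{v^\top Wv}$. At iteration $k$ there are a center $x_k$, a trust-region radius $\Delta_k\in(0,\Delta_{\max}]$, and the trust region $B(x_k,\Delta_k)$. Scaled quadratics. Let $q=(n+1)(n+2)/2$ and $q_H=n(n+1)/2$. For symmetric $H$, $\mathrm{vech}(H)\in\mathbb{R}^{q_H}$ stacks the diagonal entries and then the strictly upper-triangular entries; $\mathrm{qvec}(u)=(\tfrac12u_1^2,\dots,\tfrac12u_n^2,u_1u_2,\dots,u_{n-1}u_n)^\top$ in the same order, so that $\mathrm{qvec}(u)^\top\mathrm{vech}(H)=\frac12u^\top Hu$. Let $\widehat\phi(u)=[1;u;\mathrm{qvec}(u)]\in\mathbb{R}^q$. At center $x_k$ and radius $\Delta_k$, a coefficient vector $\widehat c=[\widehat c^{(0)};\widehat c^{(g)};\widehat c^{(H)}]\in\mathbb{R}\times\mathbb{R}^n\times\mathbb{R}^{q_H}$ represents the quadratic model $m_k(s)=\widehat\phi(s/\Delta_k)^\top\widehat c=\widehat c^{(0)}+g_k^\top s+\frac12s^\top H_ks$ with $g_k=\Delta_k^{-1}\widehat c^{(g)}$ and $\mathrm{vech}(H_k)=\Delta_k^{-2}\widehat c^{(H)}$. Interpolation. $Y_k=\{y_k^{(0)}=x_k,y_k^{(1)},\dots,y_k^{(m)}\}\subset B(x_k,c_{\mathrm{trim}}\Delta_k)$, where $m=2n$ and $c_{\mathrm{trim}}\ge1$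 is fixed. $\widehat A(Y_k)=\widehat A_k\in\mathbb{R}^{(m+1)\times q}$ has rows $\widehat\phi((y_k^{(i)}-x_k)/\Delta_k)^\top$ and $b_k=(f(y_k^{(i)}))_{i=0}^m$. Given a prior mean $\widehat c_k^\pi\in\mathbb{R}^q$ and a symmetric positive definite precision matrix $\widehat W_k\in\mathbb{R}^{q\times q}$, the hard-MAP coefficient vector is $$\widehat c_k=\arg\min_{\widehat c}\tfrac12\|\widehat c-\widehat c_k^\pi\|_{\widehat W_k}^2\ \text{ s.t. }\ \widehat A_k\widehat c=b_k ,$$ and $m_k$, $g_k=\nabla m_k(0)$, $H_k=\nabla^2m_k(0)$ are the associated model, gradient and Hessian. A set $Y$ is called MAP-poised (with threshold $\mu_M$) if $\lambda_{\min}(\widehat A(Y)\widehat W_k^{-1}\widehat A(Y)^\top)\ge\mu_M$. The BUP-TR method. Parameters: $\eta_1,\eta_2,\gamma_{\mathrm{dec}},\gamma_{\mathrm{inc}}$, $\mu_M$, repair budget $T_{\mathrm{try}}\ge1$, candidate number $N_{\mathrm{cand}}$, $\kappa_\Delta>0$, termination threshold $\Delta_{\min}\ge0$. Start with $x_0$, $\Delta_0\in(0,\Delta_{\max}]$ and $Y_0=\{x_0,\ x_0\pm\Delta_0e_i,\ i=1,\dots,n\}$, evaluated. All evaluated points are stored. Main iteration $k$: (a) Model construction and criticality loop. Repeat: a prior source supplies $(\widehat c_k^\pi,\widehat W_k)$; geometry management makes $Y_k$ MAP-poised if it is not (first by swapping in already evaluated points, then by at most $T_{\mathrm{try}}$ evaluations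 of candidate points sampled in $B(x_k,\Delta_k)$ that replace a non-center point, and, if still not MAP-poised, by resetting $Y_k$ to a MAP-poised set of already evaluated points in $B(x_k,c_{\mathrm{trim}}\Delta_k)$ or else to $\{x_k,\ x_k\pm\Delta_ke_i\}_{i=1}^n$, evaluating missing values); the hard-MAP model is formed; if $\|g_k\|_2\le\kappa_\Delta\Delta_k$, then $\Delta_k\leftarrow\gamma_{\mathrm{dec}}\Delta_k$ (a criticality shrink) and $Y_k$ is refreshed from already evaluated points. Until $\|g_k\|_2>\kappa_\Delta\Delta_k$, or $\Delta_k\le\Delta_{\min}$ (stopping test: terminate). (b) Compute a step $s_k$ approximately minimizing $m_k(s)$ over $\|s\|_2\le\Delta_k$; let $\mathrm{pred}_k=m_k(0)-m_k(s_k)$. If $\mathrm{pred}_k\le 0$ set $\rho_k=-\infty$ (no evaluation); otherwise evaluate $f(x_k+s_k)$ (one trial evaluation) and set $\rho_k=(f(x_k)-f(x_k+s_k))/\mathrm{pred}_k$. (c) If $\rho_k\ge\eta_1$ (successful) set $x_{k+1}=x_k+s_k$, else $x_{k+1}=x_k$. Set $\Delta_{k+1}=\min\{\gamma_{\mathrm{inc}}\Delta_k,\Delta_{\max}\}$ if $\rho_k\ge\eta_2$; $\Delta_{k+1}=\Delta_k$ if $\eta_1\le\rho_k<\eta_2$; $\Delta_{k+1}=\gamma_{\mathrm{dec}}\Delta_k$ if $\rho_k<\eta_1$. The interpolation set is then updated using already evaluated points only: after a successful step, $x_{k+1}$ becomes the center point and the noncenter point farthest from $x_{k+1}$ is replaced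 by $x_k$; otherwise $Y_{k+1}=Y_k$ (an evaluated rejected trial point may be inserted only through a geometry-valid replacement). Objective evaluations are the initial ones, the trial evaluations (at most one per main iteration) and the non-trial (repair) evaluations of geometry management.
   Formalization: The run is assumed never to be ended by the stopping test (automatic if Δ_min=0; otherwise the claim fails, e.g. Δ_0≤Δ_min), and the smoothness neighborhood must also contain the segments from x_k to the points of Y_k (automatic if it is convex or c_trim=1). *)

theory Defs
  imports "HOL-Analysis.Analysis" "HOL-Library.Uprod"
begin

section \<open>Index types and matrices\<close>

instance uprod :: (finite) finite
  by standard simp

text \<open>
  \<open>\<real>\<^sup>n\<close> is \<^typ>\<open>real ^ 'n\<close> with \<open>n = CARD('n)\<close>. The index type of \<open>\<real>\<^sup>q\<close> has one index for the
  constant, \<open>n\<close> for the linear part and one per unordered pair \<open>{i, j}\<close> (with \<open>i = j\<close> allowed)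
  for the half-vectorised Hessian; the order in which vech and qvec list their entries only
  permutes coordinates. The \<open>m + 1 = 2 n + 1\<close> interpolation points are indexed by
  \<^typ>\<open>('n + 'n) option\<close>, \<^term>\<open>None\<close> being the center.
\<close>

type_synonym 'n cidx = "unit + 'n + 'n uprod"
type_synonym 'n pidx = "('n + 'n) option"
type_synonym 'n points = "'n pidx \<Rightarrow> real ^ 'n"

lemma card_cidx:
  "CARD(('n::finite) cidx) = (CARD('n) + 1) * (CARD('n) + 2) div 2"
proof -
  have "CARD('n cidx) = 1 + CARD('n) + CARD('n) * (CARD('n) + 1) div 2"
    by (simp add: card_UNIV_uprod)
  also have "\<dots> = (2 * (1 + CARD('n)) + CARD('n) * (CARD('n) + 1)) div 2"
    by simp
  also have "2 * (1 + CARD('n)) + CARD('n) * (CARD('n) + 1) = (CARD('n) + 1) * (CARD('n) + 2)"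
    by (simp add: algebra_simps)
  finally show ?thesis .
qed

lemma card_pidx: "CARD(('n::finite) pidx) = 2 * CARD('n) + 1"
  by (simp add: card_UNIV_option)

definition symmetric_matrix :: "real ^ 'k ^ 'k \<Rightarrow> bool" where
  "symmetric_matrix A \<longleftrightarrow> transpose A = A"

definition spd_matrix :: "real ^ 'k ^ 'k \<Rightarrow> bool" where
  "spd_matrix A \<longleftrightarrow> symmetric_matrix A \<and> (\<forall>v. v \<noteq> 0 \<longrightarrow> v \<bullet> (A *v v) > 0)"

definition loewner_le :: "real ^ 'k ^ 'k \<Rightarrow> real ^ 'k ^ 'k \<Rightarrow> bool" (infix \<open>\<preceq>\<^sub>L\<close> 50) where
  "A \<preceq>\<^sub>L B \<longleftrightarrow> symmetric_matrix (B - A) \<and> (\<forall>v. 0 \<le> v \<bullet> ((B - A) *v v))"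

definition wnorm :: "real ^ 'k ^ 'k \<Rightarrow> real ^ 'k \<Rightarrow> real" where
  "wnorm W v = sqrt (v \<bullet> (W *v v))"

definition eigenvalue :: "real ^ 'k ^ 'k \<Rightarrow> real \<Rightarrow> bool" where
  "eigenvalue A l \<longleftrightarrow> (\<exists>v. v \<noteq> 0 \<and> A *v v = l *\<^sub>R v)"

text \<open>Used for symmetric matrices only, which do have a least real eigenvalue.\<close>

definition lambda_min :: "real ^ 'k ^ 'k \<Rightarrow> real" where
  "lambda_min A = (LEAST l. eigenvalue A l)"

definition spectral_norm :: "real ^ 'k ^ 'k \<Rightarrow> real" where
  "spectral_norm A = onorm ((*v) A)"


section \<open>Scaled quadratic models\<close>

lift_definition quad_monomial :: "real ^ 'n::finite \<Rightarrow> 'n uprod \<Rightarrow> real" is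
  "\<lambda>u (i, j). if i = j then (u $ i)\<^sup>2 / 2 else u $ i * u $ j"
  by (auto simp: mult.commute)

definition qvec :: "real ^ 'n::finite \<Rightarrow> real ^ ('n uprod)" where
  "qvec u = (\<chi> p. quad_monomial u p)"

definition coeffs :: "real \<Rightarrow> real ^ 'n::finite \<Rightarrow> real ^ ('n uprod) \<Rightarrow> real ^ ('n cidx)" where
  "coeffs a b h = (\<chi> r. case r of Inl _ \<Rightarrow> a | Inr (Inl i) \<Rightarrow> b $ i | Inr (Inr p) \<Rightarrow> h $ p)"

definition coeff_g :: "real ^ ('n::finite cidx) \<Rightarrow> real ^ 'n" where
  "coeff_g c = (\<chi> i. c $ Inr (Inl i))"

definition coeff_H :: "real ^ ('n::finite cidx) \<Rightarrow> real ^ ('n uprod)" where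
  "coeff_H c = (\<chi> p. c $ Inr (Inr p))"

text \<open>The symmetric matrix \<open>H\<close> with \<open>vech(H) = h\<close>.\<close>

definition unvech :: "real ^ ('n::finite uprod) \<Rightarrow> real ^ 'n ^ 'n" where
  "unvech h = (\<chi> i j. h $ Upair i j)"

definition phi_hat :: "real ^ 'n::finite \<Rightarrow> real ^ ('n cidx)" where
  "phi_hat u = coeffs 1 u (qvec u)"

definition model :: "real \<Rightarrow> real ^ ('n::finite cidx) \<Rightarrow> real ^ 'n \<Rightarrow> real" where
  "model \<Delta> c s = phi_hat (s /\<^sub>R \<Delta>) \<bullet> c"

definition model_grad :: "real \<Rightarrow> real ^ ('n::finite cidx) \<Rightarrow> real ^ 'n" where
  "model_grad \<Delta> c = coeff_g c /\<^sub>R \<Delta>"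

definition model_hess :: "real \<Rightarrow> real ^ ('n::finite cidx) \<Rightarrow> real ^ 'n ^ 'n" where
  "model_hess \<Delta> c = unvech (coeff_H c /\<^sub>R \<Delta>\<^sup>2)"

lemma sum_cidx: "(\<Sum>r\<in>UNIV. F r) = F (Inl ()) + (\<Sum>i\<in>UNIV. F (Inr (Inl i))) + (\<Sum>q\<in>UNIV. F (Inr (Inr q)))"
  for F :: "('n::finite) cidx \<Rightarrow> real"
proof -
  have "(\<Sum>r\<in>UNIV. F r) = (\<Sum>r\<in>(UNIV :: unit set) <+> ((UNIV :: 'n set) <+> (UNIV :: 'n uprod set)). F r)"
    by simp
  then show ?thesis by (simp only: sum.Plus finite finite_Plus) (simp add: UNIV_unit add.assoc)
qed

lemma phi_hat_inner: "phi_hat u \<bullet> c = c $ Inl () + u \<bullet> coeff_g c + qvec u \<bullet> coeff_H c"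
  by (simp add: inner_vec_def sum_cidx phi_hat_def coeffs_def coeff_g_def coeff_H_def)

lemma quad_monomial_Upair: "quad_monomial u (Upair i j) = (if i = j then (u $ i)\<^sup>2 / 2 else u $ i * u $ j)"
  by transfer simp

lemma qvec_inner: "qvec u \<bullet> h = 1/2 * (u \<bullet> (unvech h *v u))"
proof -
  let ?G = "\<lambda>(i,j). u $ i * u $ j * h $ Upair i j"
  have "u \<bullet> (unvech h *v u) = (\<Sum>i\<in>UNIV. \<Sum>j\<in>UNIV. ?G (i,j))"
    by (simp add: inner_vec_def matrix_vector_mult_def unvech_def sum_distrib_left mult_ac)
  also have "\<dots> = (\<Sum>z\<in>UNIV. ?G z)"
    by (simp add: sum.cartesian_product case_prod_unfold)
  also have "\<dots> = (\<Sum>q\<in>UNIV. \<Sum>z | case_prod Upair z = q. ?G z)"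
    using sum.group[of UNIV UNIV "case_prod Upair" ?G] by simp
  also have "\<dots> = (\<Sum>q\<in>UNIV. 2 * (quad_monomial u q * h $ q))"
  proof (rule sum.cong[OF refl])
    fix q :: "'a uprod"
    obtain a b where q: "q = Upair a b" by (cases q)
    have e: "{z. case_prod Upair z = q} = {(a,b),(b,a)}" using q by auto
    have c: "Upair b a = Upair a b" by simp
    show "(\<Sum>z | case_prod Upair z = q. ?G z) = 2 * (quad_monomial u q * h $ q)"
    proof (cases "a = b")
      case True
      then show ?thesis unfolding e by (simp add: q quad_monomial_Upair power2_eq_square)
    next
      case False
      then have "(\<Sum>z \<in> {(a,b),(b,a)}. ?G z) = ?G (a,b) + ?G (b,a)" by simp
      with False show ?thesis unfolding e by (simp only: q quad_monomial_Upair c prod.case) simp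
    qed
  qed
  finally show ?thesis by (simp add: inner_vec_def qvec_def sum_distrib_left[symmetric])
qed

text \<open>So \<open>model_grad\<close> and \<open>model_hess\<close> are the gradient and Hessian of the model at \<open>0\<close>.\<close>

lemma model_expand:
  fixes s :: "real ^ 'n::finite"
  shows "model \<Delta> c s =
     c $ Inl () + model_grad \<Delta> c \<bullet> s + 1/2 * (s \<bullet> (model_hess \<Delta> c *v s))"
proof -
  have "unvech (a *\<^sub>R h) = a *\<^sub>R unvech h" for a and h :: "real ^ ('n uprod)"
    by (simp add: vec_eq_iff unvech_def)
  then have H: "model_hess \<Delta> c *v s = (inverse (\<Delta>\<^sup>2)) *\<^sub>R (unvech (coeff_H c) *v s)"
    by (simp add: model_hess_def scaleR_matrix_vector_assoc)
  have L: "A *v (s /\<^sub>R \<Delta>) = inverse \<Delta> *\<^sub>R (A *v s)" for A :: "real ^ 'n ^ 'n"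
    by (simp add: matrix_vector_mult_scaleR)
  show ?thesis
    unfolding H model_def phi_hat_inner qvec_inner L model_grad_def inner_scaleR_left inner_scaleR_right
    by (simp only: inner_commute[of s "coeff_g c"] power2_eq_square inverse_mult_distrib mult.assoc mult.left_commute[of "1/2"])
qed

definition taylor_coeff :: "real \<Rightarrow> real \<Rightarrow> real ^ 'n::finite \<Rightarrow> real ^ ('n cidx)" where
  "taylor_coeff \<Delta> fx gx = coeffs fx (\<Delta> *\<^sub>R gx) 0"


section \<open>Hard-MAP interpolation\<close>

definition design_matrix ::
  "real ^ 'n::finite \<Rightarrow> real \<Rightarrow> 'n points \<Rightarrow> real ^ ('n cidx) ^ ('n pidx)" where
  "design_matrix x \<Delta> Y = (\<chi> i. phi_hat ((Y i - x) /\<^sub>R \<Delta>))"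

definition f_values :: "(real ^ 'n::finite \<Rightarrow> real) \<Rightarrow> 'n points \<Rightarrow> real ^ ('n pidx)" where
  "f_values f Y = (\<chi> i. f (Y i))"

definition hard_MAP ::
  "real ^ 'q ^ 'p \<Rightarrow> real ^ 'p \<Rightarrow> real ^ 'q ^ 'q \<Rightarrow> real ^ 'q \<Rightarrow> real ^ 'q \<Rightarrow> bool" where
  "hard_MAP A b W c0 c \<longleftrightarrow> is_arg_min (\<lambda>c. 1/2 * (wnorm W (c - c0))\<^sup>2) (\<lambda>c. A *v c = b) c"

definition poisedness :: "real ^ 'q ^ 'p \<Rightarrow> real ^ 'q ^ 'q \<Rightarrow> real" where
  "poisedness A W = lambda_min (A ** matrix_inv W ** transpose A)"


section \<open>The BUP-TR method\<close>

record bup_params =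
  eta1 :: real
  eta2 :: real
  gamma_dec :: real
  gamma_inc :: real
  mu_M :: real
  T_try :: nat
  N_cand :: nat
  kappa_Delta :: real
  Delta_min :: real
  Delta_max :: real
  c_trim :: real

definition coord_set :: "real ^ 'n \<Rightarrow> real \<Rightarrow> (real ^ 'n) set" where
  "coord_set x \<Delta> = {x} \<union> (\<Union>i. {x + \<Delta> *\<^sub>R axis i 1, x - \<Delta> *\<^sub>R axis i 1})"

text \<open>MAP-poised, and kept within the interpolation region \<open>B(x, c_trim \<Delta>)\<close> around the center.\<close>

definition geometry_ok ::
  "bup_params \<Rightarrow> real ^ ('n::finite cidx) ^ ('n cidx) \<Rightarrow> real ^ 'n \<Rightarrow> real \<Rightarrow> 'n points \<Rightarrow> bool" where
  "geometry_ok P W x \<Delta> Y \<longleftrightarrow>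
     Y None = x \<and> range Y \<subseteq> cball x (c_trim P * \<Delta>) \<and>
     poisedness (design_matrix x \<Delta> Y) W \<ge> mu_M P"

text \<open>\<open>E\<close> is the set of points at which \<open>f\<close> has been evaluated so far.\<close>

inductive swaps ::
  "bup_params \<Rightarrow> real ^ 'n::finite \<Rightarrow> real \<Rightarrow> (real ^ 'n) set \<Rightarrow> 'n points \<Rightarrow> 'n points \<Rightarrow> bool"
  for P x \<Delta> E Y where
  swaps_refl: "swaps P x \<Delta> E Y Y"
| swaps_step: "\<lbrakk>swaps P x \<Delta> E Y Y'; z \<in> E; z \<in> cball x (c_trim P * \<Delta>)\<rbrakk>
    \<Longrightarrow> swaps P x \<Delta> E Y (Y'(Some i := z))"

text \<open>
  \<open>samples P W x \<Delta> Y E j Y' E'\<close>: \<open>j\<close> attempts, each of which evaluates one point of a sampled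
  candidate pool \<open>Z\<close> and puts it in place of a non-center point.
\<close>

inductive samples ::
  "bup_params \<Rightarrow> real ^ ('n::finite cidx) ^ ('n cidx) \<Rightarrow> real ^ 'n \<Rightarrow> real \<Rightarrow>
   'n points \<Rightarrow> (real ^ 'n) set \<Rightarrow> nat \<Rightarrow> 'n points \<Rightarrow> (real ^ 'n) set \<Rightarrow> bool"
  for P W x \<Delta> Y E where
  samples_0: "samples P W x \<Delta> Y E 0 Y E"
| samples_Suc: "\<lbrakk>samples P W x \<Delta> Y E j Y' E'; \<not> geometry_ok P W x \<Delta> Y';
     finite Z; card Z \<le> N_cand P; Z \<subseteq> cball x \<Delta>; z \<in> Z\<rbrakk>
    \<Longrightarrow> samples P W x \<Delta> Y E (Suc j) (Y'(Some i := z)) (insert z E')"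

text \<open>
  \<open>manage_geometry P W x \<Delta> Y E Y' E' r\<close>: the incoming set \<open>Y\<close> becomes \<open>Y'\<close> at the cost of \<open>r\<close>
  objective evaluations, which enlarge the set of evaluated points from \<open>E\<close> to \<open>E'\<close>.
\<close>

inductive manage_geometry ::
  "bup_params \<Rightarrow> real ^ ('n::finite cidx) ^ ('n cidx) \<Rightarrow> real ^ 'n \<Rightarrow> real \<Rightarrow>
   'n points \<Rightarrow> (real ^ 'n) set \<Rightarrow> 'n points \<Rightarrow> (real ^ 'n) set \<Rightarrow> nat \<Rightarrow> bool"
  for P W x \<Delta> Y E where
  keep: "geometry_ok P W x \<Delta> Y \<Longrightarrow> manage_geometry P W x \<Delta> Y E Y E 0"
| repair: "\<lbrakk>\<not> geometry_ok P W x \<Delta> Y; swaps P x \<Delta> E Y Y1;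
     samples P W x \<Delta> Y1 E j Y2 E2; j \<le> T_try P; geometry_ok P W x \<Delta> Y2\<rbrakk>
    \<Longrightarrow> manage_geometry P W x \<Delta> Y E Y2 E2 j"
| reset_evaluated: "\<lbrakk>\<not> geometry_ok P W x \<Delta> Y; swaps P x \<Delta> E Y Y1;
     samples P W x \<Delta> Y1 E j Y2 E2; j \<le> T_try P; \<not> geometry_ok P W x \<Delta> Y2;
     range Y3 \<subseteq> E2; geometry_ok P W x \<Delta> Y3\<rbrakk>
    \<Longrightarrow> manage_geometry P W x \<Delta> Y E Y3 E2 j"
| reset_coord: "\<lbrakk>\<not> geometry_ok P W x \<Delta> Y; swaps P x \<Delta> E Y Y1;
     samples P W x \<Delta> Y1 E j Y2 E2; j \<le> T_try P; \<not> geometry_ok P W x \<Delta> Y2;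
     Y3 None = x; range Y3 = coord_set x \<Delta>\<rbrakk>
    \<Longrightarrow> manage_geometry P W x \<Delta> Y E Y3 (E2 \<union> coord_set x \<Delta>) (j + card (coord_set x \<Delta> - E2))"

text \<open>
  A run is indexed by the passes of the criticality loop, i.e. by the models built. Every pass
  either shrinks the radius and stays in the current main iteration or performs the
  trust-region step and starts the next one. This also covers the runs in which the criticality
  loop of some main iteration never ends. \<open>bup_state\<close> is the situation at the beginning of a
  pass (\<open>nevals\<close> counts all evaluations so far), \<open>bup_pass\<close> what is chosen and computed in it:
  prior mean and precision, interpolation set, evaluated points and number of evaluations after
  geometry management, model coefficients and trial step (the latter is irrelevant in a pass
  that ends with a criticality shrink).
\<close>

record ('n::finite) bup_state =
  center :: "real ^ 'n"
  radius :: real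
  points :: "'n points"
  evaluated :: "(real ^ 'n) set"
  nevals :: nat

record ('n) bup_pass =
  prior :: "real ^ ('n cidx)"
  prec :: "real ^ ('n cidx) ^ ('n cidx)"
  ipoints :: "'n points"
  ievaluated :: "(real ^ 'n) set"
  nrepair :: nat
  coef :: "real ^ ('n cidx)"
  trial :: "real ^ 'n"

definition pass_grad :: "'n::finite bup_state \<Rightarrow> 'n bup_pass \<Rightarrow> real ^ 'n" where
  "pass_grad S p = model_grad (radius S) (coef p)"

definition pass_hess :: "'n::finite bup_state \<Rightarrow> 'n bup_pass \<Rightarrow> real ^ 'n ^ 'n" where
  "pass_hess S p = model_hess (radius S) (coef p)"

definition pass_pred :: "'n::finite bup_state \<Rightarrow> 'n bup_pass \<Rightarrow> real" where
  "pass_pred S p = model (radius S) (coef p) 0 - model (radius S) (coef p) (trial p)"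

definition pass_matrix :: "'n::finite bup_state \<Rightarrow> 'n bup_pass \<Rightarrow> real ^ ('n cidx) ^ ('n pidx)" where
  "pass_matrix S p = design_matrix (center S) (radius S) (ipoints p)"

definition pass_rho :: "(real ^ 'n \<Rightarrow> real) \<Rightarrow> 'n::finite bup_state \<Rightarrow> 'n bup_pass \<Rightarrow> ereal" where
  "pass_rho f S p =
     (if pass_pred S p \<le> 0 then - \<infinity>
      else ereal ((f (center S) - f (center S + trial p)) / pass_pred S p))"

definition critical :: "bup_params \<Rightarrow> 'n::finite bup_state \<Rightarrow> 'n bup_pass \<Rightarrow> bool" where
  "critical P S p \<longleftrightarrow> norm (pass_grad S p) \<le> kappa_Delta P * radius S"

definition build_model ::
  "bup_params \<Rightarrow> (real ^ 'n \<Rightarrow> real) \<Rightarrow> 'n::finite bup_state \<Rightarrow> 'n bup_pass \<Rightarrow> bool" where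
  "build_model P f S p \<longleftrightarrow>
     spd_matrix (prec p) \<and>
     manage_geometry P (prec p) (center S) (radius S) (points S) (evaluated S)
       (ipoints p) (ievaluated p) (nrepair p) \<and>
     hard_MAP (pass_matrix S p) (f_values f (ipoints p)) (prec p) (prior p) (coef p)"

definition criticality_shrink ::
  "bup_params \<Rightarrow> 'n::finite bup_state \<Rightarrow> 'n bup_pass \<Rightarrow> 'n bup_state \<Rightarrow> bool" where
  "criticality_shrink P S p S' \<longleftrightarrow>
     center S' = center S \<and>
     radius S' = gamma_dec P * radius S \<and>
     points S' None = center S \<and> range (points S') \<subseteq> ievaluated p \<and>
     evaluated S' = ievaluated p \<and>
     nevals S' = nevals S + nrepair p"

definition tr_step ::
  "bup_params \<Rightarrow> (real ^ 'n \<Rightarrow> real) \<Rightarrow> 'n::finite bup_state \<Rightarrow> 'n bup_pass \<Rightarrow> 'n bup_state \<Rightarrow> bool"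
where
  "tr_step P f S p S' \<longleftrightarrow>
     (let x = center S; \<Delta> = radius S; x' = x + trial p; \<rho> = pass_rho f S p; Y = ipoints p;
          evaluate = pass_pred S p > 0
      in norm (trial p) \<le> \<Delta> \<and>
         evaluated S' = (if evaluate then insert x' (ievaluated p) else ievaluated p) \<and>
         nevals S' = nevals S + nrepair p + (if evaluate then 1 else 0) \<and>
         center S' = (if \<rho> \<ge> ereal (eta1 P) then x' else x) \<and>
         radius S' = (if \<rho> \<ge> ereal (eta2 P) then min (gamma_inc P * \<Delta>) (Delta_max P)
                      else if \<rho> \<ge> ereal (eta1 P) then \<Delta>
                      else gamma_dec P * \<Delta>) \<and>
         (if \<rho> \<ge> ereal (eta1 P)
          then \<exists>i. (\<forall>j. dist (Y (Some j)) x' \<le> dist (Y (Some i)) x') \<and>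
                   points S' = Y(None := x', Some i := x)
          else points S' = Y \<or>
               evaluate \<and> (\<exists>i. points S' = Y(Some i := x') \<and>
                                geometry_ok P (prec p) x \<Delta> (points S'))))"

text \<open>
  A pass that does not trigger the stopping test, followed by the next one. The test is made
  at the end of the pass, on the radius that is then current.
\<close>

definition bup_transition ::
  "bup_params \<Rightarrow> (real ^ 'n \<Rightarrow> real) \<Rightarrow> 'n::finite bup_state \<Rightarrow> 'n bup_pass \<Rightarrow> 'n bup_state \<Rightarrow> bool"
where
  "bup_transition P f S p S' \<longleftrightarrow>
     build_model P f S p \<and>
     (if critical P S p
      then criticality_shrink P S p S' \<and> radius S' > Delta_min P
      else radius S > Delta_min P \<and> tr_step P f S p S')"

definition bup_initial :: "bup_params \<Rightarrow> 'n::finite bup_state \<Rightarrow> bool" where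
  "bup_initial P S \<longleftrightarrow>
     0 < radius S \<and> radius S \<le> Delta_max P \<and>
     points S None = center S \<and> range (points S) = coord_set (center S) (radius S) \<and>
     evaluated S = coord_set (center S) (radius S) \<and>
     nevals S = 2 * CARD('n) + 1"

text \<open>
  A run that is never cut short by the stopping test. If \<open>Delta_min P = 0\<close>, no run is, since
  the radii are positive.
\<close>

definition bup_run ::
  "bup_params \<Rightarrow> (real ^ 'n \<Rightarrow> real) \<Rightarrow> (nat \<Rightarrow> 'n::finite bup_state) \<Rightarrow> (nat \<Rightarrow> 'n bup_pass) \<Rightarrow> bool"
where
  "bup_run P f S p \<longleftrightarrow>
     bup_initial P (S 0) \<and> (\<forall>t. bup_transition P f (S t) (p t) (S (Suc t)))"

text \<open>
  Required decrease of the trial step; \<open>norm g / spectral_norm H\<close> is read as \<open>\<infinity>\<close> when \<open>H = 0\<close>.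
\<close>

definition subproblem_decrease :: "'n::finite bup_state \<Rightarrow> 'n bup_pass \<Rightarrow> bool" where
  "subproblem_decrease S p \<longleftrightarrow>
     (let g = pass_grad S p; H = pass_hess S p; s = trial p; \<Delta> = radius S
      in (g \<noteq> 0 \<longrightarrow>
            norm s \<le> \<Delta> \<and>
            pass_pred S p \<ge> 1/2 * norm g *
              (if spectral_norm H = 0 then \<Delta> else min \<Delta> (norm g / spectral_norm H))) \<and>
         (g = 0 \<longrightarrow>
            s = 0 \<or> (norm s = \<Delta> \<and> s \<bullet> (H *v s) < 0 \<and> pass_pred S p > 0)))"

end

theory Submission
  imports Defs
begin

text \<open>
  Poisedness bounds the weighted distance from the hard-MAP coefficients to the scaled linear
  Taylor model by a multiple of \<open>\<Delta>\<^sup>2\<close>, hence the model gradient is accurate to order \<open>\<Delta>\<close>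
  and the model Hessian is bounded. Consequently a pass with \<open>\<Delta> \<le> a * norm (grad x)\<close> is neither
  critical nor unsuccessful, so the radius never falls below a multiple of \<open>\<epsilon>\<close> while the gradient
  norm exceeds \<open>\<epsilon>\<close>. Since successful passes decrease \<open>f\<close> by at least \<open>b * \<Delta>\<^sup>2\<close>, there are
  \<open>O(\<epsilon>\<^sup>-\<^sup>2)\<close> of them, and the lower bound on the radius limits the shrinks (criticality
  shrinks included) to the same order; each pass costs boundedly many evaluations.
\<close>

section \<open>Rayleigh bound and weighted norms\<close>

lemma symmetric_matrix_inner_commute:
  fixes A :: "real ^ 'k ^ 'k"
  assumes "symmetric_matrix A"
  shows "x \<bullet> (A *v y) = y \<bullet> (A *v x)"
proof -
  have "x \<bullet> (A *v y) = (transpose A *v x) \<bullet> y"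
    by (simp only: transpose_matrix_vector dot_lmul_matrix)
  then show ?thesis
    using assms by (simp only: symmetric_matrix_def inner_commute)
qed

text \<open>By compactness the quadratic form attains its minimum over the unit sphere. A
  first-order variation shows that the minimizer is an eigenvector, so the \<open>LEAST\<close> in
  \<open>lambda_min\<close> is attained there.\<close>

lemma lambda_min_le_rayleigh:
  fixes M :: "real ^ 'k ^ 'k"
  assumes sym: "symmetric_matrix M"
  shows "lambda_min M * (v \<bullet> v) \<le> v \<bullet> (M *v v)"
proof -
  have "continuous_on (sphere 0 1) (\<lambda>v :: real ^ 'k. v \<bullet> (M *v v))"
    by (intro continuous_intros matrix_vector_mult_linear_continuous_on)
  moreover have "axis undefined 1 \<in> sphere (0 :: real ^ 'k) 1"
    by simp
  then have "sphere (0 :: real ^ 'k) 1 \<noteq> {}"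
    by blast
  ultimately obtain u :: "real ^ 'k" where u: "norm u = 1"
    and u_min: "\<And>v. norm v = 1 \<Longrightarrow> u \<bullet> (M *v u) \<le> v \<bullet> (M *v v)"
    using continuous_attains_inf[of "sphere (0 :: real ^ 'k) 1"] by fastforce
  define l where "l = u \<bullet> (M *v u)"
  \<comment> \<open>Shifted by its minimum value, the form is nonnegative everywhere and vanishes at
    \<open>u\<close>, so its gradient there has to vanish.\<close>
  define q where "q v = v \<bullet> (M *v v) - l * (v \<bullet> v)" for v
  have q_nonneg: "0 \<le> q v" for v
  proof (cases "v = 0")
    case False
    have "l \<le> (v /\<^sub>R norm v) \<bullet> (M *v (v /\<^sub>R norm v))"
      using False u_min[of "v /\<^sub>R norm v"] by (simp add: l_def)
    also have "\<dots> = (v \<bullet> (M *v v)) / (v \<bullet> v)"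
      by (simp add: matrix_vector_mult_scaleR dot_square_norm power2_eq_square divide_simps)
    finally show ?thesis
      using False by (simp add: q_def field_simps)
  qed (simp add: q_def)
  \<comment> \<open>Half the gradient of \<open>q\<close> at \<open>u\<close>; it is orthogonal to
    \<open>u\<close>.\<close>
  define d where "d = M *v u - l *\<^sub>R u"
  have uu: "u \<bullet> u = 1"
    using u by (simp add: dot_square_norm)
  have q_line: "q (u + t *\<^sub>R d) = 2 * t * (d \<bullet> d) + t\<^sup>2 * q d" for t
  proof -
    have "u \<bullet> (M *v d) = d \<bullet> (M *v u)"
      by (rule symmetric_matrix_inner_commute[OF sym])
    moreover have "M *v u = d + l *\<^sub>R u"
      by (simp add: d_def)
    moreover have "d \<bullet> u = 0"
      by (simp add: d_def inner_diff_left l_def uu inner_commute[of "M *v u" u])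
    ultimately show ?thesis
      by (simp add: q_def matrix_vector_right_distrib matrix_vector_mult_scaleR inner_add_left
          inner_add_right uu inner_commute[of u d] algebra_simps power2_eq_square)
  qed
  have "d = 0"
  proof (rule ccontr)
    assume "d \<noteq> 0"
    then have dd: "0 < d \<bullet> d"
      by simp
    \<comment> \<open>A negative step so short that the linear term of \<open>q_line\<close>
      dominates. The \<open>+ 1\<close> keeps the denominator positive when
      \<open>q d = 0\<close>.\<close>
    define t where "t = - (d \<bullet> d) / (q d + 1)"
    have t: "t < 0" "t * (q d + 1) = - (d \<bullet> d)"
      using dd q_nonneg[of d] by (auto simp: t_def field_simps)
    then have "t * q d > - (d \<bullet> d)"
      by (simp add: algebra_simps)
    then have "t * (2 * (d \<bullet> d) + t * q d) < 0"
      using t(1) dd by (intro mult_neg_pos) linarith+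
    then show False
      using q_nonneg[of "u + t *\<^sub>R d"] by (simp add: q_line algebra_simps power2_eq_square)
  qed
  then have "eigenvalue M l"
    using u unfolding eigenvalue_def d_def by (intro exI[of _ u]) auto
  moreover have "l \<le> l'" if "eigenvalue M l'" for l'
  proof -
    obtain w where "w \<noteq> 0" "M *v w = l' *\<^sub>R w"
      using \<open>eigenvalue M l'\<close> by (auto simp: eigenvalue_def)
    then show ?thesis
      using q_nonneg[of w] by (simp add: q_def)
  qed
  ultimately have "lambda_min M = l"
    unfolding lambda_min_def by (rule Least_equality)
  then show ?thesis
    using q_nonneg[of v] by (simp add: q_def)
qed

section \<open>Inverses of positive definite matrices and the weighted norm\<close>

lemma invertible_of_pos_def:
  fixes A :: "real ^ 'k ^ 'k"
  assumes "\<And>v. v \<noteq> 0 \<Longrightarrow> 0 < v \<bullet> (A *v v)"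
  shows "invertible A"
proof -
  have "A *v v \<noteq> 0" if "v \<noteq> 0" for v
    using assms[OF that] by auto
  then show ?thesis
    by (auto simp: invertible_left_inverse matrix_left_invertible_ker)
qed

lemma matrix_inv_inverse:
  assumes "invertible A"
  shows "A ** matrix_inv A = mat 1" "matrix_inv A ** A = mat 1"
proof -
  have "\<exists>A'. A ** A' = mat 1 \<and> A' ** A = mat 1"
    using assms by (simp add: invertible_def)
  then have "A ** matrix_inv A = mat 1 \<and> matrix_inv A ** A = mat 1"
    unfolding matrix_inv_def by (rule someI_ex)
  then show "A ** matrix_inv A = mat 1" "matrix_inv A ** A = mat 1"
    by auto
qed

lemma spd_matrix_invertible:
  "spd_matrix W \<Longrightarrow> invertible W"
  by (rule invertible_of_pos_def) (simp add: spd_matrix_def)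

lemma spd_matrix_nonneg:
  "spd_matrix W \<Longrightarrow> 0 \<le> v \<bullet> (W *v v)"
  by (cases "v = 0") (auto simp: spd_matrix_def less_imp_le)

lemma wnorm_power2:
  "spd_matrix W \<Longrightarrow> (wnorm W v)\<^sup>2 = v \<bullet> (W *v v)"
  by (simp add: wnorm_def spd_matrix_nonneg)

lemma wnorm_minus_commute: "wnorm W (u - v) = wnorm W (v - u)"
  by (simp add: wnorm_def algebra_simps)

text \<open>Parallelogram law with the nonnegative term for \<open>u - v\<close> dropped.\<close>

lemma wnorm_add_power2_le:
  assumes "spd_matrix W"
  shows "(wnorm W (u + v))\<^sup>2 \<le> 2 * (wnorm W u)\<^sup>2 + 2 * (wnorm W v)\<^sup>2"
  using spd_matrix_nonneg[OF assms, of "u - v"]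
  by (simp add: wnorm_power2[OF assms] matrix_vector_right_distrib
      matrix_vector_mult_diff_distrib algebra_simps)

text \<open>Transposing \<open>W ** matrix_inv W = mat 1\<close> makes the transposed inverse a left
  inverse of \<open>W\<close>, which must equal the right inverse.\<close>

lemma symmetric_matrix_inv:
  fixes W :: "real ^ 'k ^ 'k"
  assumes "symmetric_matrix W" "invertible W"
  shows "symmetric_matrix (matrix_inv W)"
proof -
  have "transpose (matrix_inv W) ** W = mat 1"
    using matrix_transpose_mul[of W "matrix_inv W"] assms matrix_inv_inverse[of W]
    by (simp add: symmetric_matrix_def transpose_mat)
  then have "transpose (matrix_inv W) ** (W ** matrix_inv W) = matrix_inv W"
    by (simp add: matrix_mul_assoc)
  then show ?thesis
    using assms by (simp add: symmetric_matrix_def matrix_inv_inverse)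
qed

section \<open>Accuracy of the hard-MAP model\<close>

text \<open>
  The competitor \<open>c' = cl + W\<^sup>-\<^sup>1 A\<^sup>T z\<close> with \<open>A W\<^sup>-\<^sup>1 A\<^sup>T z = b - A cl\<close> interpolates and
  satisfies \<open>wnorm W (c' - cl)\<^sup>2 = z \<bullet> (b - A cl) \<le> norm (b - A cl)\<^sup>2 / mu\<close>.
\<close>

lemma hard_MAP_error:
  fixes A :: "real ^ 'q ^ 'p" and W :: "real ^ 'q ^ 'q"
  assumes W: "spd_matrix W" and map: "hard_MAP A b W c0 c"
    and mu: "0 < mu" "mu \<le> poisedness A W"
  shows "(wnorm W (c - cl))\<^sup>2 \<le> 6 * (wnorm W (c0 - cl))\<^sup>2 + 4 * (norm (b - A *v cl))\<^sup>2 / mu"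
proof -
  define V where "V = matrix_inv W"
  define M where "M = A ** V ** transpose A"
  define r where "r = b - A *v cl"
  have WV: "W ** V = mat 1"
    using W by (simp add: V_def matrix_inv_inverse spd_matrix_invertible)
  have symV: "symmetric_matrix V"
    using W unfolding V_def
    by (intro symmetric_matrix_inv spd_matrix_invertible) (auto simp: spd_matrix_def)
  then have "symmetric_matrix M"
    by (simp add: symmetric_matrix_def M_def matrix_transpose_mul matrix_mul_assoc)
  then have "lambda_min M * (v \<bullet> v) \<le> v \<bullet> (M *v v)" for v
    by (rule lambda_min_le_rayleigh)
  moreover have "mu * (v \<bullet> v) \<le> lambda_min M * (v \<bullet> v)" for v
    using mu by (intro mult_right_mono) (auto simp: poisedness_def M_def V_def)
  \<comment> \<open>Poisedness read as coercivity of \<open>M\<close>; this makes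
    \<open>M *v z = r\<close> solvable.\<close>
  ultimately have M_ge: "mu * (v \<bullet> v) \<le> v \<bullet> (M *v v)" for v
    by (rule order_trans[rotated])
  have "0 < v \<bullet> (M *v v)" if "v \<noteq> 0" for v
  proof -
    have "0 < mu * (v \<bullet> v)"
      using mu(1) that by simp
    then show ?thesis
      using M_ge by (rule less_le_trans)
  qed
  then have "invertible M"
    by (rule invertible_of_pos_def)
  then have "M *v (matrix_inv M *v r) = r"
    by (simp add: matrix_vector_mul_assoc matrix_inv_inverse)
  then obtain z where z: "M *v z = r"
    by blast
  \<comment> \<open>The correction added to \<open>cl\<close>. Since
    \<open>W *v e = transpose A *v z\<close>, its squared weighted norm collapses to
    \<open>z \<bullet> r\<close>.\<close>
  define e where "e = V *v (transpose A *v z)"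
  have Ae: "A *v e = r"
    using z by (simp add: e_def M_def matrix_vector_mul_assoc matrix_mul_assoc
        del: transpose_matrix_vector)
  have "(wnorm W e)\<^sup>2 = e \<bullet> (transpose A *v z)"
    by (simp add: wnorm_power2[OF W] e_def matrix_vector_mul_assoc WV matrix_mul_assoc)
  also have "\<dots> = z \<bullet> r"
    using dot_lmul_matrix[of z A e] by (simp add: Ae inner_commute)
  finally have We: "(wnorm W e)\<^sup>2 = z \<bullet> r" .
  \<comment> \<open>Coercivity bounds \<open>z \<bullet> r\<close> from below, Cauchy-Schwarz from
    above; one factor \<open>norm z\<close> then cancels.\<close>
  have "mu * norm z * norm z \<le> norm r * norm z"
    using M_ge[of z] norm_cauchy_schwarz[of z r]
    by (simp add: z dot_square_norm power2_eq_square mult.assoc mult.commute[of "norm r"])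
  then have "mu * norm z \<le> norm r"
    by (cases "z = 0") auto
  then have "norm z \<le> norm r / mu"
    using mu by (simp add: field_simps)
  then have "z \<bullet> r \<le> norm r / mu * norm r"
    using norm_cauchy_schwarz[of z r] mult_right_mono[of "norm z" "norm r / mu" "norm r"] by simp
  then have e_le: "(wnorm W e)\<^sup>2 \<le> (norm r)\<^sup>2 / mu"
    by (subst We) (simp add: power2_eq_square)
  have "A *v (cl + e) = b"
    by (simp add: matrix_vector_right_distrib Ae r_def)
  \<comment> \<open>Minimality of \<open>c\<close> against the feasible point
    \<open>cl + e\<close>.\<close>
  then have "(wnorm W (c - c0))\<^sup>2 \<le> (wnorm W (cl + e - c0))\<^sup>2"
    using map by (auto simp: hard_MAP_def is_arg_min_def not_less)
  also have "cl + e - c0 = (cl - c0) + e"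
    by simp
  also have "(wnorm W \<dots>)\<^sup>2 \<le> 2 * (wnorm W (c0 - cl))\<^sup>2 + 2 * (wnorm W e)\<^sup>2"
    using wnorm_add_power2_le[OF W] by (metis wnorm_minus_commute)
  finally have "(wnorm W (c - c0))\<^sup>2 \<le> 2 * (wnorm W (c0 - cl))\<^sup>2 + 2 * (norm r)\<^sup>2 / mu"
    using e_le by simp
  \<comment> \<open>The second use of the parallelogram bound produces the constants
    \<open>6 = 2 * 2 + 2\<close> and \<open>4 = 2 * 2\<close>.\<close>
  moreover have "(wnorm W (c - cl))\<^sup>2 \<le> 2 * (wnorm W (c - c0))\<^sup>2 + 2 * (wnorm W (c0 - cl))\<^sup>2"
    using wnorm_add_power2_le[OF W, of "c - c0" "c0 - cl"] by simp
  ultimately show ?thesis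
    by (simp add: r_def)
qed

section \<open>Linearization error and comparison of norms\<close>

lemma loewner_mat_le:
  fixes W :: "real ^ 'k ^ 'k"
  assumes "mat w \<preceq>\<^sub>L W"
  shows "w * (v \<bullet> v) \<le> v \<bullet> (W *v v)"
proof -
  have "mat w = w *\<^sub>R (mat 1 :: real ^ 'k ^ 'k)"
    by (simp add: mat_def vec_eq_iff)
  then have "mat w *v v = w *\<^sub>R v"
    by (simp flip: scaleR_matrix_vector_assoc)
  moreover have "v \<bullet> (mat w *v v) \<le> v \<bullet> (W *v v)"
    using assms by (simp add: loewner_le_def matrix_vector_mult_diff_rdistrib inner_diff_right)
  ultimately show ?thesis
    by simp
qed

text \<open>The mean value theorem along the segment yields an intermediate gradient within
  \<open>L * norm (y - x)\<close> of \<open>grad x\<close>. This gives the constant \<open>L\<close>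
  rather than the sharp \<open>L / 2\<close>, and only the segment has to lie in
  \<open>U\<close>.\<close>

lemma GDERIV_lipschitz_linear_error:
  fixes f :: "'a::real_inner \<Rightarrow> real"
  assumes seg: "closed_segment x y \<subseteq> U"
    and deriv: "\<And>z. z \<in> U \<Longrightarrow> GDERIV f z :> grad z"
    and lip: "L-lipschitz_on U grad"
  shows "\<bar>f y - f x - grad x \<bullet> (y - x)\<bar> \<le> L * (norm (y - x))\<^sup>2"
proof -
  define pt where "pt t = x + t *\<^sub>R (y - x)" for t :: real
  have pt: "pt t \<in> closed_segment x y" if "0 \<le> t" "t \<le> 1" for t
    using that by (auto simp: closed_segment_def pt_def algebra_simps intro!: exI[of _ t])
  have "DERIV (\<lambda>t. f (pt t)) t :> (y - x) \<bullet> grad (pt t)" if "0 \<le> t" "t \<le> 1" for t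
  proof -
    have "(pt has_derivative (\<lambda>h. h *\<^sub>R (y - x))) (at t)"
      unfolding pt_def by (auto intro!: derivative_eq_intros)
    moreover have "(f has_derivative (\<lambda>h. h \<bullet> grad (pt t))) (at (pt t))"
      using deriv[of "pt t"] pt[OF that] seg by (auto simp: gderiv_def)
    ultimately have "((\<lambda>t. f (pt t)) has_derivative (\<lambda>h. (h *\<^sub>R (y - x)) \<bullet> grad (pt t))) (at t)"
      by (rule has_derivative_compose)
    then show ?thesis
      by (simp add: has_field_derivative_def mult.commute[of _ "(y - x) \<bullet> grad (pt t)"] mult_commute_abs)
  qed
  then obtain t where t: "0 < t" "t < 1"
    and "f (pt 1) - f (pt 0) = (1 - 0) * ((y - x) \<bullet> grad (pt t))"
    using MVT2[of 0 1 "\<lambda>t. f (pt t)" "\<lambda>t. (y - x) \<bullet> grad (pt t)"] by auto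
  then have "f y - f x - grad x \<bullet> (y - x) = (grad (pt t) - grad x) \<bullet> (y - x)"
    by (simp add: pt_def inner_diff_left inner_diff_right inner_commute)
  then have "\<bar>f y - f x - grad x \<bullet> (y - x)\<bar> \<le> norm (grad (pt t) - grad x) * norm (y - x)"
    by (simp add: Cauchy_Schwarz_ineq2)
  also have "norm (grad (pt t) - grad x) \<le> L * norm (pt t - x)"
    using lipschitz_onD[OF lip, of "pt t" x] pt[of t] pt[of 0] t seg by (auto simp: dist_norm pt_def)
  also have "L * norm (pt t - x) \<le> L * norm (y - x)"
    using lipschitz_on_nonneg[OF lip] t
    by (intro mult_left_mono) (auto simp: pt_def mult_left_le_one_le)
  finally show ?thesis
    by (simp add: power2_eq_square mult.assoc mult_right_mono)
qed

lemma norm_power2_le_card: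
  fixes r :: "real ^ 'k"
  assumes "\<And>i. \<bar>r $ i\<bar> \<le> B"
  shows "(norm r)\<^sup>2 \<le> real CARD('k) * B\<^sup>2"
proof -
  have "(norm r)\<^sup>2 = (\<Sum>i\<in>UNIV. (r $ i)\<^sup>2)"
    by (simp only: power2_norm_eq_inner inner_vec_def) (simp add: power2_eq_square)
  also have "\<dots> \<le> real (card (UNIV :: 'k set)) * B\<^sup>2"
    using power_mono[OF assms abs_ge_zero, of _ 2] by (intro sum_bounded_above) (simp only: power2_abs)
  finally show ?thesis .
qed

text \<open>Pythagoras over the constant, gradient and Hessian blocks.\<close>

lemma norm_coeff_parts_le:
  fixes c :: "real ^ ('n::finite cidx)"
  shows "norm (coeff_g c) \<le> norm c" "norm (coeff_H c) \<le> norm c"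
proof -
  have *: "(norm c)\<^sup>2 = (c $ Inl ())\<^sup>2 + (norm (coeff_g c))\<^sup>2 + (norm (coeff_H c))\<^sup>2"
    by (simp only: power2_norm_eq_inner inner_vec_def sum_cidx)
      (simp add: coeff_g_def coeff_H_def power2_eq_square)
  have nn: "0 \<le> (c $ Inl ())\<^sup>2" "0 \<le> (norm (coeff_g c))\<^sup>2" "0 \<le> (norm (coeff_H c))\<^sup>2"
    by (rule zero_le_power2)+
  from * nn have **: "(norm (coeff_g c))\<^sup>2 \<le> (norm c)\<^sup>2" "(norm (coeff_H c))\<^sup>2 \<le> (norm c)\<^sup>2"
    by linarith+
  from **(1) show "norm (coeff_g c) \<le> norm c"
    by (rule power2_le_imp_le) (rule norm_ge_zero)
  from **(2) show "norm (coeff_H c) \<le> norm c"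
    by (rule power2_le_imp_le) (rule norm_ge_zero)
qed

text \<open>Every matrix entry is a component of \<open>h\<close>; the square of the dimension comes
  from the crude entrywise bound on the operator norm.\<close>

lemma spectral_norm_unvech_le:
  fixes h :: "real ^ ('n::finite uprod)"
  shows "spectral_norm (unvech h) \<le> real CARD('n) * real CARD('n) * norm h"
  unfolding spectral_norm_def
  by (rule onorm_le_matrix_component) (simp add: unvech_def component_le_norm_cart)

section \<open>Interpolation sets and the error of the coefficients\<close>

lemma coord_set_subset_cball: "0 \<le> \<Delta> \<Longrightarrow> coord_set x \<Delta> \<subseteq> cball x \<Delta>"
  by (auto simp: coord_set_def dist_norm)

text \<open>All outcomes but the coordinate reset end with \<open>geometry_ok\<close>; the reset
  stays in the smaller ball of radius \<open>\<Delta>\<close>.\<close>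

lemma manage_geometry_points:
  assumes "manage_geometry P W x \<Delta> Y E Y' E' r" "0 \<le> \<Delta>" "1 \<le> c_trim P"
  shows "Y' None = x" "range Y' \<subseteq> cball x (c_trim P * \<Delta>)"
proof -
  have "cball x \<Delta> \<subseteq> cball x (c_trim P * \<Delta>)"
    using assms mult_right_mono[of 1 "c_trim P" \<Delta>] by (intro subset_cball) simp
  then have "coord_set x \<Delta> \<subseteq> cball x (c_trim P * \<Delta>)"
    using coord_set_subset_cball[OF \<open>0 \<le> \<Delta>\<close>] by blast
  with assms(1) have "geometry_ok P W x \<Delta> Y' \<or> Y' None = x \<and> range Y' \<subseteq> cball x (c_trim P * \<Delta>)"
    by (induction rule: manage_geometry.induct) auto
  then have "Y' None = x \<and> range Y' \<subseteq> cball x (c_trim P * \<Delta>)"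
    by (auto simp: geometry_ok_def)
  then show "Y' None = x" "range Y' \<subseteq> cball x (c_trim P * \<Delta>)"
    by auto
qed

text \<open>The scalings by \<open>\<Delta>\<close> cancel, so the interpolation residual at the
  Taylor coefficients is the vector of linearization errors of \<open>f\<close>.\<close>

lemma design_matrix_taylor_coeff:
  assumes "\<Delta> \<noteq> 0"
  shows "(design_matrix x \<Delta> Y *v taylor_coeff \<Delta> a v) $ i = a + v \<bullet> (Y i - x)"
proof -
  have "(design_matrix x \<Delta> Y *v taylor_coeff \<Delta> a v) $ i
      = phi_hat ((Y i - x) /\<^sub>R \<Delta>) \<bullet> taylor_coeff \<Delta> a v"
    by (simp add: matrix_vector_mul_component design_matrix_def)
  moreover have "coeff_g (taylor_coeff \<Delta> a v) = \<Delta> *\<^sub>R v" "coeff_H (taylor_coeff \<Delta> a v) = 0"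
    by (simp_all add: vec_eq_iff coeff_g_def coeff_H_def taylor_coeff_def coeffs_def)
  ultimately show ?thesis
    using assms by (simp add: phi_hat_inner taylor_coeff_def coeffs_def inner_commute)
qed

text \<open>The residual and the prior error are both of order \<open>\<Delta>\<^sup>2\<close>, so
  \<open>hard_MAP_error\<close> gives that order in the weighted norm; dividing by \<open>w\<close>
  passes to the Euclidean norm.\<close>

lemma hard_MAP_taylor_error:
  fixes Y :: "'n::finite points"
  assumes \<Delta>: "0 < \<Delta>" and Y: "range Y \<subseteq> cball x (c * \<Delta>)"
    and seg: "\<And>i. closed_segment x (Y i) \<subseteq> U"
    and deriv: "\<And>z. z \<in> U \<Longrightarrow> GDERIV f z :> grad z" and lip: "L-lipschitz_on U grad"
    and W: "spd_matrix W" "0 < w" "mat w \<preceq>\<^sub>L W"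
    and map: "hard_MAP (design_matrix x \<Delta> Y) (f_values f Y) W c0 d"
    and mu: "0 < mu" "mu \<le> poisedness (design_matrix x \<Delta> Y) W"
    and prior: "wnorm W (c0 - taylor_coeff \<Delta> (f x) (grad x)) \<le> k * \<Delta>\<^sup>2"
  shows "norm (d - taylor_coeff \<Delta> (f x) (grad x))
    \<le> sqrt ((6 * k\<^sup>2 + 4 * (real CARD('n pidx) * (L * c\<^sup>2)\<^sup>2) / mu) / w) * \<Delta>\<^sup>2"
proof -
  define cl where "cl = taylor_coeff \<Delta> (f x) (grad x)"
  define r where "r = f_values f Y - design_matrix x \<Delta> Y *v cl"
  have "\<bar>r $ i\<bar> \<le> L * c\<^sup>2 * \<Delta>\<^sup>2" for i
  proof -
    have "\<bar>r $ i\<bar> = \<bar>f (Y i) - f x - grad x \<bullet> (Y i - x)\<bar>"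
      using \<Delta> by (simp add: r_def cl_def design_matrix_taylor_coeff f_values_def)
    also have "\<dots> \<le> L * (norm (Y i - x))\<^sup>2"
      by (rule GDERIV_lipschitz_linear_error[OF seg deriv lip])
    also have "norm (Y i - x) \<le> c * \<Delta>"
      using Y by (auto simp: dist_norm norm_minus_commute image_subset_iff)
    then have "L * (norm (Y i - x))\<^sup>2 \<le> L * (c * \<Delta>)\<^sup>2"
      using lipschitz_on_nonneg[OF lip] by (intro mult_left_mono power_mono) auto
    finally show ?thesis
      by (simp add: power_mult_distrib mult.assoc)
  qed
  then have "(norm r)\<^sup>2 \<le> real CARD('n pidx) * (L * c\<^sup>2 * \<Delta>\<^sup>2)\<^sup>2"
    by (rule norm_power2_le_card)
  then have r: "4 * (norm r)\<^sup>2 / mu \<le> 4 * (real CARD('n pidx) * (L * c\<^sup>2 * \<Delta>\<^sup>2)\<^sup>2) / mu"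
    using mu by (intro divide_right_mono mult_left_mono) auto
  have "0 \<le> wnorm W (c0 - cl)"
    by (simp add: wnorm_def spd_matrix_nonneg[OF W(1)])
  then have p: "(wnorm W (c0 - cl))\<^sup>2 \<le> (k * \<Delta>\<^sup>2)\<^sup>2"
    using prior by (intro power_mono) (auto simp: cl_def)
  have "w * (norm (d - cl))\<^sup>2 \<le> (wnorm W (d - cl))\<^sup>2"
    using loewner_mat_le[OF W(3)] by (simp add: wnorm_power2[OF W(1)] power2_norm_eq_inner)
  also have "\<dots> \<le> 6 * (wnorm W (c0 - cl))\<^sup>2 + 4 * (norm r)\<^sup>2 / mu"
    unfolding r_def by (rule hard_MAP_error[OF W(1) map mu])
  also have "\<dots> \<le> 6 * (k * \<Delta>\<^sup>2)\<^sup>2 + 4 * (real CARD('n pidx) * (L * c\<^sup>2 * \<Delta>\<^sup>2)\<^sup>2) / mu"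
    using r p by simp
  also have "\<dots> = (6 * k\<^sup>2 + 4 * (real CARD('n pidx) * (L * c\<^sup>2)\<^sup>2) / mu) * (\<Delta>\<^sup>2)\<^sup>2"
    by (simp only: power_mult_distrib) (simp add: algebra_simps)
  finally have "(norm (d - cl))\<^sup>2
      \<le> (6 * k\<^sup>2 + 4 * (real CARD('n pidx) * (L * c\<^sup>2)\<^sup>2) / mu) / w * (\<Delta>\<^sup>2)\<^sup>2"
    using W by (simp add: pos_le_divide_eq mult.commute)
  then have "norm (d - cl) \<le> sqrt (\<dots>)"
    by (rule real_le_rsqrt)
  then show ?thesis
    unfolding cl_def real_sqrt_mult by (simp only: real_sqrt_abs abs_power2)
qed

text \<open>Unscaling costs one power of \<open>\<Delta>\<close> for the gradient and two for the
  Hessian.\<close>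

lemma model_accuracy_of_coeff_error:
  fixes d :: "real ^ ('n::finite cidx)"
  assumes \<Delta>: "0 < \<Delta>" and err: "norm (d - taylor_coeff \<Delta> a v) \<le> k * \<Delta>\<^sup>2"
  shows "norm (model_grad \<Delta> d - v) \<le> k * \<Delta>"
    and "spectral_norm (model_hess \<Delta> d) \<le> real CARD('n) * real CARD('n) * k"
proof -
  let ?e = "d - taylor_coeff \<Delta> a v"
  have "model_grad \<Delta> d - v = coeff_g ?e /\<^sub>R \<Delta>"
    using \<Delta> by (simp add: vec_eq_iff model_grad_def coeff_g_def taylor_coeff_def coeffs_def field_simps)
  then have "norm (model_grad \<Delta> d - v) = norm (coeff_g ?e) / \<Delta>"
    using \<Delta> by (simp add: divide_inverse mult.commute)
  also have "norm (coeff_g ?e) \<le> k * \<Delta>\<^sup>2"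
    using norm_coeff_parts_le(1) err by (rule order_trans)
  then have "norm (coeff_g ?e) / \<Delta> \<le> k * \<Delta>"
    using \<Delta> by (simp add: field_simps power2_eq_square)
  finally show "norm (model_grad \<Delta> d - v) \<le> k * \<Delta>" .
  \<comment> \<open>The Taylor coefficients have no Hessian block, so that of \<open>d\<close> is
    pure error.\<close>
  have "coeff_H d = coeff_H ?e"
    by (simp add: vec_eq_iff coeff_H_def taylor_coeff_def coeffs_def)
  then have "norm (coeff_H d /\<^sub>R \<Delta>\<^sup>2) \<le> k"
    using \<Delta> order_trans[OF norm_coeff_parts_le(2) err] by (simp add: field_simps)
  then have "real CARD('n) * real CARD('n) * norm (coeff_H d /\<^sub>R \<Delta>\<^sup>2) \<le> real CARD('n) * real CARD('n) * k"
    by (intro mult_left_mono) auto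
  then show "spectral_norm (model_hess \<Delta> d) \<le> real CARD('n) * real CARD('n) * k"
    unfolding model_hess_def using spectral_norm_unvech_le order_trans by blast
qed

lemma model_decrease_error:
  fixes s :: "real ^ 'n::finite"
  assumes f: "\<bar>f (x + s) - f x - v \<bullet> s\<bar> \<le> L * (norm s)\<^sup>2"
    and g: "norm (model_grad \<Delta> d - v) \<le> k * \<Delta>" and H: "spectral_norm (model_hess \<Delta> d) \<le> k"
    and s: "norm s \<le> \<Delta>" and nonneg: "0 \<le> L" "0 \<le> k"
  shows "\<bar>f x - f (x + s) - (model \<Delta> d 0 - model \<Delta> d s)\<bar> \<le> (L + 2 * k) * \<Delta>\<^sup>2"
proof -
  let ?H = "model_hess \<Delta> d"
  have ss: "(norm s)\<^sup>2 \<le> \<Delta>\<^sup>2"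
    using s by (intro power_mono) auto
  have "\<bar>(model_grad \<Delta> d - v) \<bullet> s\<bar> \<le> k * \<Delta> * \<Delta>"
    using Cauchy_Schwarz_ineq2 mult_mono[OF g s order_trans[OF norm_ge_zero g] norm_ge_zero]
    by (rule order_trans)
  moreover have "\<bar>s \<bullet> (?H *v s)\<bar> \<le> k * \<Delta>\<^sup>2"
  proof -
    have "norm (?H *v s) \<le> spectral_norm ?H * norm s"
      unfolding spectral_norm_def by (rule onorm) (rule matrix_vector_mul_bounded_linear)
    also have "\<dots> \<le> k * norm s"
      using H by (rule mult_right_mono) simp
    finally have "norm s * norm (?H *v s) \<le> norm s * (k * norm s)"
      by (rule mult_left_mono) simp
    also have "\<dots> = k * (norm s)\<^sup>2"
      by (simp add: power2_eq_square)
    also have "\<dots> \<le> k * \<Delta>\<^sup>2"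
      using ss nonneg by (intro mult_left_mono)
    finally show ?thesis
      using Cauchy_Schwarz_ineq2 order_trans by blast
  qed
  moreover have "\<bar>f (x + s) - f x - v \<bullet> s\<bar> \<le> L * \<Delta>\<^sup>2"
    using f mult_left_mono[OF ss, of L] nonneg by linarith
  \<comment> \<open>The discrepancy splits into Taylor remainder, gradient error and curvature; the
    factor \<open>1/2\<close> of the last is given away in \<open>2 * k\<close>.\<close>
  moreover have "f x - f (x + s) - (model \<Delta> d 0 - model \<Delta> d s)
      = - (f (x + s) - f x - v \<bullet> s) + (model_grad \<Delta> d - v) \<bullet> s + 1/2 * (s \<bullet> (?H *v s))"
    by (simp add: model_expand inner_diff_left)
  moreover have "(L + 2 * k) * \<Delta>\<^sup>2 = L * \<Delta>\<^sup>2 + k * \<Delta> * \<Delta> + k * \<Delta>\<^sup>2"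
    by (simp add: algebra_simps power2_eq_square)
  moreover have "0 \<le> k * \<Delta>\<^sup>2"
    using nonneg by simp
  ultimately show ?thesis
    by linarith
qed

section \<open>Progress of a single pass\<close>

lemma spectral_norm_nonneg: "0 \<le> spectral_norm A"
  unfolding spectral_norm_def by (rule onorm_pos_le) (rule matrix_vector_mul_bounded_linear)

text \<open>An upper bound \<open>k\<close> on the Hessian norm removes the case of a vanishing
  Hessian: the quotient by \<open>k\<close> is the smaller one, and the minimum never exceeds the
  radius.\<close>

lemma subproblem_decrease_bound:
  assumes dec: "subproblem_decrease S p" and g: "pass_grad S p \<noteq> 0"
    and H: "spectral_norm (pass_hess S p) \<le> k"
  shows "norm (trial p) \<le> radius S"
    and "1/2 * norm (pass_grad S p) * min (radius S) (norm (pass_grad S p) / k) \<le> pass_pred S p"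
proof -
  let ?g = "pass_grad S p" and ?h = "spectral_norm (pass_hess S p)"
  let ?m = "if ?h = 0 then radius S else min (radius S) (norm ?g / ?h)"
  have dec': "norm (trial p) \<le> radius S" "1/2 * norm ?g * ?m \<le> pass_pred S p"
    using dec g by (auto simp: subproblem_decrease_def Let_def)
  have "norm ?g / k \<le> norm ?g / ?h" if "?h \<noteq> 0"
    using that H spectral_norm_nonneg[of "pass_hess S p"] by (intro divide_left_mono) auto
  then have "min (radius S) (norm ?g / k) \<le> ?m"
    by auto
  then have "1/2 * norm ?g * min (radius S) (norm ?g / k) \<le> 1/2 * norm ?g * ?m"
    by (intro mult_left_mono) auto
  then show "norm (trial p) \<le> radius S"
    and "1/2 * norm ?g * min (radius S) (norm ?g / k) \<le> pass_pred S p"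
    using dec' by auto
qed

text \<open>With \<open>v\<close> as the true gradient, this is the dichotomy that the counting
  argument consumes. Critical passes and unsuccessful steps share the second alternative, since both
  shrink the radius and keep the center.\<close>

lemma bup_transition_progress:
  fixes f :: "real ^ 'n::finite \<Rightarrow> real" and S S' :: "'n bup_state"
  defines "\<Delta> \<equiv> radius S"
  assumes trans: "bup_transition P f S p S'" and \<Delta>: "0 < \<Delta>" "\<Delta> \<le> Delta_max P"
    and params: "0 < eta1 P" "eta1 P \<le> eta2 P" "eta2 P < 1" "1 < gamma_inc P" "0 < kappa_Delta P"
    and dec: "\<not> critical P S p \<Longrightarrow> subproblem_decrease S p"
    and k: "0 < k" and M: "0 < M"
    and g_acc: "norm (pass_grad S p - v) \<le> k * \<Delta>"
    and H_acc: "spectral_norm (pass_hess S p) \<le> k"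
    and pred_acc: "norm (trial p) \<le> \<Delta> \<Longrightarrow>
      \<bar>f (center S) - f (center S + trial p) - pass_pred S p\<bar> \<le> M * \<Delta>\<^sup>2"
    and a: "0 \<le> a" "a * (2 * (kappa_Delta P + k)) \<le> 1" "a * (4 * M) \<le> 1 - eta2 P"
  shows "f (center S') \<le> f (center S)
           - eta1 P * (1/2 * kappa_Delta P * min 1 (kappa_Delta P / k)) * \<Delta>\<^sup>2 \<and>
         \<Delta> \<le> radius S' \<and> radius S' \<le> gamma_inc P * \<Delta> \<or>
         f (center S') = f (center S) \<and> radius S' = gamma_dec P * \<Delta> \<and> a * norm v < \<Delta>"
proof (cases "critical P S p")
  case True
  then have S': "center S' = center S" "radius S' = gamma_dec P * \<Delta>"
    using trans by (auto simp: bup_transition_def criticality_shrink_def \<Delta>_def)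
  have "norm (pass_grad S p) \<le> kappa_Delta P * \<Delta>"
    using True by (simp add: critical_def \<Delta>_def)
  then have "norm v \<le> (kappa_Delta P + k) * \<Delta>"
    using g_acc norm_triangle_ineq3[of "pass_grad S p" v] by (simp only: distrib_right)
  \<comment> \<open>The factor \<open>2\<close> in the condition on \<open>a\<close> leaves
    \<open>\<Delta> / 2\<close>, hence a strict inequality.\<close>
  then have "a * norm v \<le> a * ((kappa_Delta P + k) * \<Delta>)"
    using a by (intro mult_left_mono)
  also have "\<dots> = a * (2 * (kappa_Delta P + k)) * (\<Delta> / 2)"
    by simp
  also have "\<dots> \<le> 1 * (\<Delta> / 2)"
    using a \<Delta> by (intro mult_right_mono) auto
  finally show ?thesis
    using S' \<Delta> by simp
next
  case False
  let ?g = "norm (pass_grad S p)" and ?x = "center S" and ?q = "kappa_Delta P"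
  have g: "?q * \<Delta> < ?g"
    using False by (simp add: critical_def \<Delta>_def)
  moreover have "0 < ?q * \<Delta>"
    using \<Delta> params by simp
  ultimately have g0: "pass_grad S p \<noteq> 0"
    by auto
  have s: "norm (trial p) \<le> \<Delta>" and pred: "1/2 * ?g * min \<Delta> (?g / k) \<le> pass_pred S p"
    using subproblem_decrease_bound[OF dec[OF False] g0 H_acc] by (auto simp: \<Delta>_def)
  \<comment> \<open>Noncriticality replaces the model gradient norm by \<open>?q * \<Delta>\<close>,
    turning the predicted decrease into a multiple of \<open>\<Delta>\<^sup>2\<close>.\<close>
  have "1/2 * ?q * min 1 (?q / k) * \<Delta>\<^sup>2 = 1/2 * (?q * \<Delta>) * (min 1 (?q / k) * \<Delta>)"
    by (simp add: power2_eq_square)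
  also have "min 1 (?q / k) * \<Delta> = min \<Delta> (?q * \<Delta> / k)"
    using \<Delta> by (simp add: min_mult_distrib_right)
  also have "1/2 * (?q * \<Delta>) * \<dots> \<le> 1/2 * ?g * min \<Delta> (?g / k)"
    using g k \<Delta> params by (intro mult_mono min.mono divide_right_mono) auto
  finally have pred_ge: "1/2 * ?q * min 1 (?q / k) * \<Delta>\<^sup>2 \<le> pass_pred S p"
    using pred by linarith
  moreover have "0 < 1/2 * ?q * min 1 (?q / k) * \<Delta>\<^sup>2"
    using params k \<Delta> by simp
  ultimately have pred_pos: "0 < pass_pred S p"
    by linarith
  have rho: "ereal e \<le> pass_rho f S p \<longleftrightarrow> e * pass_pred S p \<le> f ?x - f (?x + trial p)" for e
    using pred_pos by (simp add: pass_rho_def pos_le_divide_eq)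
  have step: "tr_step P f S p S'"
    using trans False by (simp add: bup_transition_def)
  show ?thesis
  proof (cases "ereal (eta1 P) \<le> pass_rho f S p")
    case True
    have "eta1 P * (1/2 * ?q * min 1 (?q / k) * \<Delta>\<^sup>2) \<le> eta1 P * pass_pred S p"
      using pred_ge params by (intro mult_left_mono) auto
    then have "f (center S') \<le> f ?x - eta1 P * (1/2 * ?q * min 1 (?q / k)) * \<Delta>\<^sup>2"
      using True step rho[of "eta1 P"] by (simp add: tr_step_def Let_def)
    moreover have "\<Delta> \<le> gamma_inc P * \<Delta>"
      using \<Delta> params by simp
    then have "\<Delta> \<le> radius S'" "radius S' \<le> gamma_inc P * \<Delta>"
      using True step \<Delta> by (auto simp: tr_step_def Let_def \<Delta>_def)
    ultimately show ?thesis
      by blast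
  next
    case not_successful: False
    \<comment> \<open>A ratio below \<open>eta1 P\<close> is also below \<open>eta2 P\<close>, so
      the radius update takes its last branch.\<close>
    then have "\<not> ereal (eta2 P) \<le> pass_rho f S p"
      using params by (meson ereal_less_eq(3) order_trans)
    then have S': "center S' = ?x" "radius S' = gamma_dec P * \<Delta>"
      using not_successful step by (auto simp: tr_step_def Let_def \<Delta>_def)
    have "a * norm v < \<Delta>"
    proof (rule ccontr)
      assume "\<not> a * norm v < \<Delta>"
      then have av: "\<Delta> \<le> a * norm v"
        by simp
      \<comment> \<open>A radius this small makes the gradient error at most half of
        \<open>norm v\<close>. Then \<open>norm v \<le> 2 * ?g\<close>, the minimum in
        \<open>pred\<close> is \<open>\<Delta>\<close>, and the predicted decrease is at least
        \<open>norm v * \<Delta> / 4\<close>.\<close>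
      have "2 * k * \<Delta> \<le> 2 * (?q + k) * (a * norm v)"
        using av k \<Delta> params by (intro mult_mono) auto
      also have "\<dots> = (a * (2 * (?q + k))) * norm v"
        by simp
      also have "\<dots> \<le> 1 * norm v"
        using a by (intro mult_right_mono) auto
      finally have v: "2 * k * \<Delta> \<le> norm v"
        by simp
      have vg: "norm v \<le> ?g + k * \<Delta>"
        using g_acc norm_triangle_ineq3[of "pass_grad S p" v] by linarith
      then have gv: "norm v \<le> 2 * ?g" "k * \<Delta> \<le> ?g"
        using v by linarith+
      then have "min \<Delta> (?g / k) = \<Delta>"
        using k by (simp add: pos_le_divide_eq mult.commute)
      with pred have "1/2 * ?g * \<Delta> \<le> pass_pred S p"
        by simp
      then have "norm v * \<Delta> \<le> 4 * pass_pred S p"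
        using mult_right_mono[OF gv(1) less_imp_le[OF \<Delta>(1)]] by linarith
      \<comment> \<open>The second condition on \<open>a\<close> puts the model error below
        \<open>(1 - eta2 P)\<close> times the predicted decrease, so the ratio reaches
        \<open>eta2 P\<close>.\<close>
      have "M * \<Delta>\<^sup>2 \<le> M * (a * norm v) * \<Delta>"
        using av M \<Delta> by (simp add: power2_eq_square)
      also have "\<dots> = (a * (4 * M)) * (norm v * \<Delta> / 4)"
        by simp
      also have "\<dots> \<le> (1 - eta2 P) * pass_pred S p"
        using a M \<Delta> params \<open>norm v * \<Delta> \<le> 4 * pass_pred S p\<close> by (intro mult_mono) auto
      finally have "M * \<Delta>\<^sup>2 \<le> (1 - eta2 P) * pass_pred S p" .
      then have "eta2 P * pass_pred S p \<le> f ?x - f (?x + trial p)"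
        using pred_acc[OF s] by (simp add: algebra_simps)
      moreover have "eta1 P * pass_pred S p \<le> eta2 P * pass_pred S p"
        using params pred_pos by simp
      ultimately show False
        using not_successful rho[of "eta1 P"] by simp
    qed
    then show ?thesis
      using S' by simp
  qed
qed

section \<open>Radius and evaluation bookkeeping\<close>

lemma bup_transition_radius:
  assumes "bup_transition P f S p S'" "0 < radius S" "radius S \<le> Delta_max P"
    "0 < gamma_dec P" "gamma_dec P < 1" "1 < gamma_inc P"
  shows "0 < radius S'" "radius S' \<le> Delta_max P"
proof -
  have "gamma_dec P * radius S \<le> 1 * radius S"
    using assms by (intro mult_right_mono) auto
  then have "gamma_dec P * radius S \<le> Delta_max P"
    using assms(3) by linarith
  then have "0 < radius S' \<and> radius S' \<le> Delta_max P"
    using assms by (auto simp: bup_transition_def criticality_shrink_def tr_step_def Let_def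
        split: if_splits)
  then show "0 < radius S'" "radius S' \<le> Delta_max P"
    by auto
qed

lemma bup_transition_nevals:
  "bup_transition P f S p S' \<Longrightarrow> nevals S' \<le> nevals S + nrepair p + 1"
  by (auto simp: bup_transition_def criticality_shrink_def tr_step_def Let_def split: if_splits)

section \<open>Counting passes\<close>

text \<open>
  Up to the first \<open>t\<close> with \<open>G t \<le> \<epsilon>\<close>, the radius stays above a multiple of \<open>\<epsilon>\<close>, so the potential
  \<open>K / \<epsilon>\<^sup>2 * F t + ln (D t)\<close> drops by a fixed amount at every step, successful or not.
\<close>

lemma trust_region_complexity:
  fixes F D G :: "nat \<Rightarrow> real"
  assumes D_pos: "\<And>t. 0 < D t" and F_ge: "\<And>t. F_low \<le> F t"
    and params: "0 < \<gamma>" "\<gamma> < 1" "1 < \<Gamma>" "0 < a" "0 < b"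
    and step: "\<And>t. F (Suc t) \<le> F t - b * (D t)\<^sup>2 \<and> D t \<le> D (Suc t) \<and> D (Suc t) \<le> \<Gamma> * D t \<or>
                   F (Suc t) = F t \<and> D (Suc t) = \<gamma> * D t \<and> a * G t < D t"
  shows "\<exists>C>0. \<forall>\<epsilon>. 0 < \<epsilon> \<and> \<epsilon> \<le> 1 \<longrightarrow> (\<exists>t. real t \<le> C / \<epsilon>\<^sup>2 \<and> G t \<le> \<epsilon>)"
proof -
  \<comment> \<open>\<open>c * \<epsilon>\<close> will bound the radius from below; the minimum with
    \<open>D 0\<close> serves the base case and makes \<open>ln (D 0 / c)\<close>
    nonnegative.\<close>
  define c where "c = min (\<gamma> * a) (D 0)"
  have c: "0 < c" "c \<le> \<gamma> * a" "c \<le> D 0"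
    using params D_pos by (auto simp: c_def)
  \<comment> \<open>The drop of \<open>ln (D t)\<close> in a shrink.\<close>
  define \<delta> where "\<delta> = - ln \<gamma>"
  have \<delta>: "0 < \<delta>"
    using params by (simp add: \<delta>_def)
  \<comment> \<open>Chosen so that the decrease of \<open>F\<close> in a successful step pays for
    the growth \<open>ln \<Gamma>\<close> of the logarithm and still leaves
    \<open>\<delta>\<close>.\<close>
  define K where "K = (ln \<Gamma> + \<delta>) / (b * c\<^sup>2)"
  have K: "0 < K"
    using c params \<delta> by (auto simp: K_def intro!: divide_pos_pos add_pos_pos)
  \<comment> \<open>Total possible drop of the potential, divided by the drop per step; the
    \<open>1\<close> accounts for \<open>ln (1 / \<epsilon>)\<close>.\<close>
  define C where "C = (K * (F 0 - F_low) + ln (D 0 / c) + 1) / \<delta>"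
  have C: "0 < C"
    unfolding C_def using K F_ge[of 0] c \<delta> D_pos[of 0]
    by (intro divide_pos_pos add_nonneg_pos add_nonneg_nonneg) auto
  have bound: "real N \<le> C / \<epsilon>\<^sup>2" if eps: "0 < \<epsilon>" "\<epsilon> \<le> 1" and G: "\<And>t. t < N \<Longrightarrow> \<epsilon> < G t" for N \<epsilon>
  proof -
    \<comment> \<open>Only a shrink lowers \<open>D\<close>. It requires
      \<open>a * G t < D t\<close>, and \<open>\<epsilon> < G t\<close> for \<open>t < N\<close>, so
      the new value is still at least \<open>\<gamma> * a * \<epsilon>\<close>.\<close>
    have D_ge: "c * \<epsilon> \<le> D t" if "t \<le> N" for t
      using that
    proof (induction t)
      case 0
      then show ?case
        using c eps mult_left_mono[of \<epsilon> 1 c] by linarith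
    next
      case (Suc t)
      show ?case
        using step[of t]
      proof
        assume "F (Suc t) = F t \<and> D (Suc t) = \<gamma> * D t \<and> a * G t < D t"
        moreover have "a * \<epsilon> \<le> a * G t"
          using G[of t] Suc.prems params by simp
        ultimately have "a * \<epsilon> \<le> D t" "D (Suc t) = \<gamma> * D t"
          by auto
        then have "\<gamma> * (a * \<epsilon>) \<le> D (Suc t)"
          using params by simp
        moreover have "c * \<epsilon> \<le> \<gamma> * a * \<epsilon>"
          using c eps by (intro mult_right_mono) auto
        ultimately show ?thesis
          by (simp add: mult.assoc)
      qed (use Suc in auto)
    qed
    define \<Phi> where "\<Phi> t = K / \<epsilon>\<^sup>2 * F t + ln (D t)" for t
    have \<Phi>_step: "\<Phi> (Suc t) \<le> \<Phi> t - \<delta>" if "t < N" for t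
      using step[of t]
    proof
      assume A: "F (Suc t) \<le> F t - b * (D t)\<^sup>2 \<and> D t \<le> D (Suc t) \<and> D (Suc t) \<le> \<Gamma> * D t"
      have "(c * \<epsilon>)\<^sup>2 \<le> (D t)\<^sup>2"
        using D_ge[of t] that c eps by (intro power_mono) auto
      then have "b * (c * \<epsilon>)\<^sup>2 \<le> b * (D t)\<^sup>2"
        using params by simp
      then have "K / \<epsilon>\<^sup>2 * F (Suc t) \<le> K / \<epsilon>\<^sup>2 * (F t - b * (c * \<epsilon>)\<^sup>2)"
        using A K by (intro mult_left_mono) auto
      also have "\<dots> = K / \<epsilon>\<^sup>2 * F t - (ln \<Gamma> + \<delta>)"
        using eps c params by (simp add: K_def field_simps)
      finally have "K / \<epsilon>\<^sup>2 * F (Suc t) \<le> K / \<epsilon>\<^sup>2 * F t - (ln \<Gamma> + \<delta>)" .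
      moreover have "ln (D (Suc t)) \<le> ln (\<Gamma> * D t)"
        using A D_pos by (intro ln_mono) auto
      then have "ln (D (Suc t)) \<le> ln \<Gamma> + ln (D t)"
        using params D_pos[of t] by (simp add: ln_mult)
      ultimately show ?thesis
        by (simp add: \<Phi>_def)
    next
      assume "F (Suc t) = F t \<and> D (Suc t) = \<gamma> * D t \<and> a * G t < D t"
      then show ?thesis
        using params D_pos[of t] by (simp add: \<Phi>_def \<delta>_def ln_mult)
    qed
    have "\<Phi> t \<le> \<Phi> 0 - real t * \<delta>" if "t \<le> N" for t
      using that
    proof (induction t)
      case (Suc t)
      then show ?case
        using \<Phi>_step[of t] by (simp add: algebra_simps)
    qed simp
    then have "real N * \<delta> \<le> \<Phi> 0 - \<Phi> N"
      by fastforce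
    also have "\<dots> = K / \<epsilon>\<^sup>2 * (F 0 - F N) + (ln (D 0) - ln (D N))"
      by (simp add: \<Phi>_def right_diff_distrib diff_divide_distrib)
    also have "\<dots> \<le> K / \<epsilon>\<^sup>2 * (F 0 - F_low) + (ln (D 0) - ln (c * \<epsilon>))"
      using K F_ge[of N] D_ge[of N] D_pos[of N] c eps
      by (intro add_mono mult_left_mono diff_left_mono ln_mono) auto
    also have "ln (D 0) - ln (c * \<epsilon>) = ln (D 0 / c) + ln (1 / \<epsilon>)"
      using D_pos[of 0] c eps by (simp add: ln_div ln_mult)
    \<comment> \<open>Because \<open>\<epsilon> \<le> 1\<close>, both the constant and the logarithm
      are absorbed into the order \<open>1 / \<epsilon>\<^sup>2\<close>.\<close>
    also have "K / \<epsilon>\<^sup>2 * (F 0 - F_low) + (ln (D 0 / c) + ln (1 / \<epsilon>))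
      \<le> K / \<epsilon>\<^sup>2 * (F 0 - F_low) + (ln (D 0 / c) / \<epsilon>\<^sup>2 + 1 / \<epsilon>\<^sup>2)"
    proof -
      have e2: "1 \<le> 1 / \<epsilon>\<^sup>2" "1 / \<epsilon> \<le> 1 / \<epsilon>\<^sup>2"
        using eps by (auto simp: power2_eq_square field_simps mult_le_one)
      have "ln (D 0 / c) \<le> ln (D 0 / c) / \<epsilon>\<^sup>2"
        using mult_left_mono[OF e2(1), of "ln (D 0 / c)"] c by simp
      moreover have "ln (1 / \<epsilon>) \<le> 1 / \<epsilon>\<^sup>2"
        using ln_le_minus_one[of "1 / \<epsilon>"] e2 eps by simp
      ultimately show ?thesis
        by simp
    qed
    also have "\<dots> = C * \<delta> / \<epsilon>\<^sup>2"
    proof -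
      have "C * \<delta> = K * (F 0 - F_low) + ln (D 0 / c) + 1"
        using \<delta> by (simp add: C_def)
      then show ?thesis
        by (simp add: add_divide_distrib)
    qed
    finally have "real N * \<delta> \<le> C / \<epsilon>\<^sup>2 * \<delta>"
      by simp
    then show ?thesis
      using \<delta> by (simp only: mult_le_cancel_right_pos)
  qed
  have "\<exists>t. real t \<le> C / \<epsilon>\<^sup>2 \<and> G t \<le> \<epsilon>" if eps: "0 < \<epsilon>" "\<epsilon> \<le> 1" for \<epsilon>
  proof -
    \<comment> \<open>The first integer above \<open>C / \<epsilon>\<^sup>2\<close>, so
      \<open>bound\<close> fails for it; any \<open>t < N\<close> is at most the floor.\<close>
    define N where "N = Suc (nat \<lfloor>C / \<epsilon>\<^sup>2\<rfloor>)"
    have "C / \<epsilon>\<^sup>2 < real N"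
      unfolding N_def by linarith
    then obtain t where "t < N" "G t \<le> \<epsilon>"
      using bound[OF eps, of N] by fastforce
    moreover have "real (nat \<lfloor>C / \<epsilon>\<^sup>2\<rfloor>) \<le> C / \<epsilon>\<^sup>2"
      using C by simp
    ultimately show ?thesis
      unfolding N_def by (intro exI[of _ t]) auto
  qed
  then show ?thesis
    using C by blast
qed

section \<open>Choice of constants and conversion of passes into evaluations\<close>

theorem theorem4p21:
  fixes P :: bup_params
    and f :: "real ^ 'n \<Rightarrow> real"
    and grad :: "real ^ 'n \<Rightarrow> real ^ 'n"
    and U :: "(real ^ 'n) set"
    and S :: "nat \<Rightarrow> 'n bup_state"
    and p :: "nat \<Rightarrow> 'n bup_pass"
    and L_g f_inf w_min w_max kappa_pi :: real
  assumes run: "bup_run P f S p"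
    and method_params: "1 \<le> c_trim P" "1 \<le> T_try P" "0 \<le> Delta_min P"
    and smooth: "open U"
      "\<And>t. cball (center (S t)) (radius (S t)) \<subseteq> U"
      "\<And>t i. closed_segment (center (S t)) (ipoints (p t) i) \<subseteq> U"
      "\<And>x. x \<in> U \<Longrightarrow> GDERIV f x :> grad x"
      "continuous_on U grad"
      "0 < L_g" "L_g-lipschitz_on U grad"
    and bounded_below: "\<And>x. f_inf \<le> f x"
    and tr_params: "0 < eta1 P" "eta1 P \<le> eta2 P" "eta2 P < 1"
      "0 < gamma_dec P" "gamma_dec P < 1" "1 < gamma_inc P"
    and decrease: "\<And>t. \<not> critical P (S t) (p t) \<Longrightarrow> subproblem_decrease (S t) (p t)"
    and precision: "0 < w_min" "w_min \<le> w_max"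
      "\<And>t. mat w_min \<preceq>\<^sub>L prec (p t)" "\<And>t. prec (p t) \<preceq>\<^sub>L mat w_max"
    and poised: "0 < mu_M P" "\<And>t. mu_M P \<le> poisedness (pass_matrix (S t) (p t)) (prec (p t))"
    and prior_accuracy: "0 \<le> kappa_pi"
      "\<And>t. wnorm (prec (p t))
             (prior (p t) - taylor_coeff (radius (S t)) (f (center (S t))) (grad (center (S t))))
           \<le> kappa_pi * (radius (S t))\<^sup>2"
    and safeguard: "0 < kappa_Delta P"
    and repair_cost: "mu_M P \<le> 1 / (w_max * (4 * real CARD('n) + 3))"
      "\<And>t. nrepair (p t) \<le> T_try P + 2 * CARD('n)"
  shows "\<exists>C_eval > 0. \<forall>\<epsilon>. 0 < \<epsilon> \<and> \<epsilon> \<le> 1 \<longrightarrow>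
           (\<exists>t. real (nevals (S t)) \<le> C_eval * \<epsilon> powr (- 2) \<and>
                norm (grad (center (S t))) \<le> \<epsilon>)"
proof -
  define N where "N = real CARD('n)"
  define k0 where
    "k0 = sqrt ((6 * kappa_pi\<^sup>2
      + 4 * (real CARD('n pidx) * (L_g * (c_trim P)\<^sup>2)\<^sup>2) / mu_M P) / w_min)"
  \<comment> \<open>One constant for both gradient and Hessian accuracy: \<open>N * N\<close> comes
    from the entrywise matrix bound, and \<open>+ 1\<close> ensures positivity.\<close>
  define k where "k = max 1 (N * N) * (k0 + 1)"
  define M where "M = L_g + 2 * k"
  \<comment> \<open>The two quotients are the two requirements on \<open>a\<close> in
    \<open>bup_transition_progress\<close>.\<close>
  define a where "a = min (1 / (2 * (kappa_Delta P + k))) ((1 - eta2 P) / (4 * M))"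
  define b where "b = eta1 P * (1/2 * kappa_Delta P * min 1 (kappa_Delta P / k))"
  have k0: "0 \<le> k0"
    using precision poised by (simp add: k0_def)
  have "1 * (k0 + 1) \<le> k"
    unfolding k_def using k0 by (intro mult_right_mono) auto
  then have k: "k0 \<le> k" "0 < k"
    using k0 by auto
  have "N * N * k0 \<le> max 1 (N * N) * (k0 + 1)"
    using k0 by (intro mult_mono) auto
  then have kN: "N * N * k0 \<le> k"
    by (simp add: k_def)
  have M: "0 < M"
    using k smooth(6) by (simp add: M_def)
  have a_pos: "0 < a"
    using tr_params M k safeguard by (simp add: a_def)
  have "a \<le> 1 / (2 * (kappa_Delta P + k))" "a \<le> (1 - eta2 P) / (4 * M)"
    by (simp_all add: a_def)
  then have a: "a * (2 * (kappa_Delta P + k)) \<le> 1" "a * (4 * M) \<le> 1 - eta2 P"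
    using M k safeguard by (simp_all add: pos_le_divide_eq)
  have b: "0 < b"
    using tr_params k safeguard by (simp add: b_def)
  have init: "bup_initial P (S 0)" and trans: "bup_transition P f (S t) (p t) (S (Suc t))" for t
    using run by (auto simp: bup_run_def)
  have radius: "0 < radius (S t) \<and> radius (S t) \<le> Delta_max P" for t
  proof (induction t)
    case 0
    then show ?case
      using init by (simp add: bup_initial_def)
  next
    case (Suc t)
    then show ?case
      using bup_transition_radius[OF trans[of t]] tr_params by blast
  qed
  have step: "f (center (S (Suc t))) \<le> f (center (S t)) - b * (radius (S t))\<^sup>2 \<and>
      radius (S t) \<le> radius (S (Suc t)) \<and> radius (S (Suc t)) \<le> gamma_inc P * radius (S t) \<or>
      f (center (S (Suc t))) = f (center (S t)) \<and> radius (S (Suc t)) = gamma_dec P * radius (S t) \<and>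
      a * norm (grad (center (S t))) < radius (S t)" for t
  proof -
    let ?x = "center (S t)" and ?\<Delta> = "radius (S t)"
    have \<Delta>: "0 < ?\<Delta>" "?\<Delta> \<le> Delta_max P"
      using radius[of t] by auto
    have model: "spd_matrix (prec (p t))"
      "manage_geometry P (prec (p t)) ?x ?\<Delta> (points (S t)) (evaluated (S t))
        (ipoints (p t)) (ievaluated (p t)) (nrepair (p t))"
      "hard_MAP (design_matrix ?x ?\<Delta> (ipoints (p t))) (f_values f (ipoints (p t)))
        (prec (p t)) (prior (p t)) (coef (p t))"
      using trans[of t] by (auto simp: bup_transition_def build_model_def pass_matrix_def)
    have "range (ipoints (p t)) \<subseteq> cball ?x (c_trim P * ?\<Delta>)"
      using manage_geometry_points(2)[OF model(2)] \<Delta> method_params by simp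
    then have err: "norm (coef (p t) - taylor_coeff ?\<Delta> (f ?x) (grad ?x)) \<le> k0 * ?\<Delta>\<^sup>2"
      unfolding k0_def
      by (rule hard_MAP_taylor_error[OF \<Delta>(1) _ smooth(3,4,7) model(1) precision(1,3) model(3)
            poised(1) poised(2)[unfolded pass_matrix_def] prior_accuracy(2)])
    have g_acc: "norm (pass_grad (S t) (p t) - grad ?x) \<le> k * ?\<Delta>"
      using model_accuracy_of_coeff_error(1)[OF \<Delta>(1) err]
        mult_right_mono[OF k(1) less_imp_le[OF \<Delta>(1)]]
      unfolding pass_grad_def by (rule order_trans)
    have H_acc: "spectral_norm (pass_hess (S t) (p t)) \<le> k"
      using model_accuracy_of_coeff_error(2)[OF \<Delta>(1) err] kN by (simp add: pass_hess_def N_def)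
    have pred_acc: "\<bar>f ?x - f (?x + trial (p t)) - pass_pred (S t) (p t)\<bar> \<le> M * ?\<Delta>\<^sup>2"
      if s: "norm (trial (p t)) \<le> ?\<Delta>"
    proof -
      \<comment> \<open>The trial segment stays in the trust region, where the gradient is
        Lipschitz.\<close>
      have "closed_segment ?x (?x + trial (p t)) \<subseteq> cball ?x ?\<Delta>"
        using s \<Delta> by (intro closed_segment_subset) (auto simp: dist_norm)
      then have "closed_segment ?x (?x + trial (p t)) \<subseteq> U"
        using smooth(2) by blast
      then have "\<bar>f (?x + trial (p t)) - f ?x - grad ?x \<bullet> trial (p t)\<bar> \<le> L_g * (norm (trial (p t)))\<^sup>2"
        using GDERIV_lipschitz_linear_error[OF _ smooth(4,7)] by fastforce
      then show ?thesis
        unfolding pass_pred_def M_def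
        using g_acc H_acc s smooth(6) k unfolding pass_grad_def pass_hess_def
        by (intro model_decrease_error) auto
    qed
    show ?thesis
      unfolding b_def
      by (rule bup_transition_progress[OF trans \<Delta> tr_params(1-3,6) safeguard decrease k(2) M
            g_acc H_acc pred_acc less_imp_le[OF a_pos] a])
  qed
  obtain C where C: "0 < C"
    and *: "\<And>\<epsilon>. 0 < \<epsilon> \<Longrightarrow> \<epsilon> \<le> 1 \<Longrightarrow> \<exists>t. real t \<le> C / \<epsilon>\<^sup>2 \<and> norm (grad (center (S t))) \<le> \<epsilon>"
    using trust_region_complexity[where F = "\<lambda>t. f (center (S t))" and D = "\<lambda>t. radius (S t)"
        and G = "\<lambda>t. norm (grad (center (S t)))" and a = a and b = b,
        OF _ bounded_below tr_params(4-6) a_pos b step] radius by metis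
  \<comment> \<open>Largest cost of one pass: the repair bound plus one trial evaluation.\<close>
  define c where "c = T_try P + 2 * CARD('n) + 1"
  have nevals: "nevals (S t) \<le> (2 * CARD('n) + 1) + c * t" for t
  proof (induction t)
    case 0
    then show ?case
      using init by (simp add: bup_initial_def)
  next
    case (Suc t)
    then show ?case
      using bup_transition_nevals[OF trans[of t]] repair_cost(2)[of t] by (simp add: c_def)
  qed
  \<comment> \<open>The initial evaluations are absorbed since
    \<open>1 \<le> 1 / \<epsilon>\<^sup>2\<close>.\<close>
  define C_eval where "C_eval = real (2 * CARD('n) + 1) + real c * C"
  have "\<exists>t. real (nevals (S t)) \<le> C_eval * \<epsilon> powr (- 2) \<and> norm (grad (center (S t))) \<le> \<epsilon>"
    if eps: "0 < \<epsilon>" "\<epsilon> \<le> 1" for \<epsilon>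
  proof -
    obtain t where t: "real t \<le> C / \<epsilon>\<^sup>2" "norm (grad (center (S t))) \<le> \<epsilon>"
      using *[OF eps] by blast
    have "real (nevals (S t)) \<le> real (2 * CARD('n) + 1) + real c * real t"
      using nevals[of t] by (metis of_nat_add of_nat_le_iff of_nat_mult)
    also have "\<dots> \<le> real (2 * CARD('n) + 1) / \<epsilon>\<^sup>2 + real c * (C / \<epsilon>\<^sup>2)"
    proof (intro add_mono mult_left_mono t)
      have "\<epsilon>\<^sup>2 \<le> 1"
        using eps by (simp add: power_le_one)
      then show "real (2 * CARD('n) + 1) \<le> real (2 * CARD('n) + 1) / \<epsilon>\<^sup>2"
        using eps mult_left_mono[of "\<epsilon>\<^sup>2" 1 "real (2 * CARD('n) + 1)"] by (simp add: pos_le_divide_eq)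
    qed simp
    also have "\<dots> = C_eval * \<epsilon> powr (- 2)"
      using eps by (simp add: C_eval_def powr_minus_divide powr_numeral add_divide_distrib)
    finally show ?thesis
      using t by blast
  qed
  moreover have "0 < C_eval"
    using C by (simp add: C_eval_def add_pos_nonneg)
  ultimately show ?thesis
    by blast
qed

end
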